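(* Let $d\ge1$ and let $M\subseteq A^{A^d}$ be a set of $d$-ary operations on the finite set $A$. Then $\;{}^{d}\overline{M}=\mathrm{Pol}^{(d)}\,{}^{d}\mathrm{GQuord}\,M$.
   Context: Standing assumptions: $A$ is a finite nonempty set; all sets $B,B_i$ are finite and nonempty. $\mathrm{Op}(A)$ is the set of all operations $f:A^n\to A$, $n\ge1$. A clone is a subset of $\mathrm{Op}(A)$ containing all projections and closed under composition; $\langle F\rangle$ is the clone generated by $F$, $F^{(d)}$ the set of $d$-ary members of $F$. A $d$-ary clone fragment is a set $N\subseteq A^{A^d}$ with $N=\langle N\rangle^{(d)}$ (notation $N\le A^{A^d}$). $\mathrm{trl}_d(f)$, for $f:A^n\to A$, is the set of all $d$-ary operations obtained from $f$ by substituting constants from $A$ for some (possibly none, possibly all) of its variables, keeping the remaining $t\le d$ variables in their order, and then prepending $u$ and appending $v$ fictitious variables, $u+t+v=d$. For $N\subseteq A^{A^d}$, $N^{*_d}:=\{f\in\mathrm{Op}(A)\mid\mathrm{trl}_d(f)\subseteq N\}$. With $\mathcal C^{(d)}$ the set of $d$-ary constant operations on $A$, $${}^{d}\overline{M}:=\bigcap\{N\mid M\cup\mathcal C^{(d)}\subseteq N\le A^{A^d}\text{ and }N^{*_d}\text{ is a clone}\}.$$ R-relations. For $h:B^{n+1}\to A$, $\mathrm{ebtrl}(h)$ is the set of all $(x_0,\dots,x_{n-1})\mapsto h(x_0,\dots,x_{i-1},c,x_i,\dots,x_{n-1})$ with $0\le i\le n$, $c\in B$. For $g:B^n\to A$,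 $\mathrm{eftrl}(g)$ consists of $(x_0,\dots,x_n)\mapsto g(x_1,\dots,x_n)$ and $(x_0,\dots,x_n)\mapsto g(x_0,\dots,x_{n-1})$. For $\rho\subseteq A^{B^d}$: $\circledast(\rho):=\{h\in A^{B^{d+1}}\mid\mathrm{ebtrl}(h)\subseteq\rho\}$. For $h\in A^{B^{d+1}}$, $\mathbf\Delta(h)$ is the set of all $(x_0,\dots,x_{d-1})\mapsto h(x_0,\dots,x_{j-1},x_i,x_j,\dots,x_{d-1})$, $0\le i<j\le d$. (Extended to sets by unions.) $\rho\subseteq A^{B^d}$ is internally reflexive if $\mathrm{eftrl}(\rho)\subseteq\circledast(\rho)$, transitive if $\mathbf\Delta(\circledast(\rho))\subseteq\rho$. An R-relation of arity $\alpha=\alpha_1\times\dots\times\alpha_s$, $\alpha_j=B_j^{d_j}$, is a set $\rho\subseteq A^\alpha$ of functions $\alpha\to A$; its dimension is $d_1+\dots+d_s$. With $\alpha/\alpha_j$ the product with $j$-th factor deleted and $g^{(\alpha_j)}:\alpha_j\to A^{\alpha/\alpha_j}$ the currying $g^{(\alpha_j)}(X_j)(X_1,\dots,X_{j-1},X_{j+1},\dots,X_s)=g(X_1,\dots,X_s)$, put $\rho^{(\alpha_j)}:=\{g^{(\alpha_j)}\mid g\in\rho\}$, a relation of simple arity $B_j^{d_j}$ over base set $A^{\alpha/\alpha_j}$. $\rho$ is internally reflexive (transitive) if all $\rho^{(\alpha_j)}$ are; $\rho$ is a generalized quasiorder if it is internally reflexive, transitive and contains all constant functions $\alpha\to A$.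 ${}^{d}\mathrm{GQuord}(A)$ is the set of all $d$-dimensional generalized quasiorders on $A$ of canonical arity $m_1^{d_1}\times\dots\times m_s^{d_s}$, $m_i,d_i\ge1$, where $m_i=\{0,\dots,m_i-1\}$ ($A$ is identified with the ordinal $|A|$, so that $A^d$ is canonical). $f:A^n\to A$ preserves $\rho\subseteq A^\alpha$ if for all $g_1,\dots,g_n\in\rho$ the function $b\mapsto f(g_1(b),\dots,g_n(b))$ is in $\rho$. ${}^{d}\mathrm{GQuord}\,M$ is the set of all $\rho\in{}^{d}\mathrm{GQuord}(A)$ preserved by all members of $M$; $\mathrm{Pol}^{(d)}T$ is the set of all $d$-ary operations on $A$ preserving all members of $T$. *)

theory Defs
  imports HOL.Hull "HOL-Library.FuncSet"
begin

text \<open>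
  An element of \<open>B\<^sup>n\<close> is a list of length \<open>n\<close>. Every function with a restricted domain is
  extensional (\<^term>\<open>undefined\<close> outside its domain), so that equality is equality of functions.
\<close>

definition tuples :: "'b set \<Rightarrow> nat \<Rightarrow> 'b list set" where
  "tuples B n = {xs. set xs \<subseteq> B \<and> length xs = n}"

definition ops :: "'a set \<Rightarrow> nat \<Rightarrow> ('a list \<Rightarrow> 'a) set" where
  "ops A n = tuples A n \<rightarrow>\<^sub>E A"

text \<open>
  An extensional function does not determine its domain (consider the constant \<^term>\<open>undefined\<close>),
  so operations of unspecified arity carry their arity explicitly.
\<close>

type_synonym 'a operation = "nat \<times> ('a list \<Rightarrow> 'a)"

definition Op :: "'a set \<Rightarrow> 'a operation set" where
  "Op A = {(n, f). 1 \<le> n \<and> f \<in> ops A n}"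

definition level :: "'a operation set \<Rightarrow> nat \<Rightarrow> ('a list \<Rightarrow> 'a) set" where
  "level F n = {f. (n, f) \<in> F}"

definition projection :: "'a set \<Rightarrow> nat \<Rightarrow> nat \<Rightarrow> 'a list \<Rightarrow> 'a" where
  "projection A n i = (\<lambda>x\<in>tuples A n. x ! i)"

definition compose_op :: "'a set \<Rightarrow> nat \<Rightarrow> ('a list \<Rightarrow> 'a) \<Rightarrow> ('a list \<Rightarrow> 'a) list \<Rightarrow> 'a list \<Rightarrow> 'a" where
  "compose_op A k f gs = (\<lambda>x\<in>tuples A k. f (map (\<lambda>g. g x) gs))"

definition is_clone :: "'a set \<Rightarrow> 'a operation set \<Rightarrow> bool" where
  "is_clone A C \<longleftrightarrow> C \<subseteq> Op A \<and>
     (\<forall>n i. i < n \<longrightarrow> (n, projection A n i) \<in> C) \<and>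
     (\<forall>n f k gs. (n, f) \<in> C \<longrightarrow> 1 \<le> k \<longrightarrow> gs \<in> tuples (level C k) n \<longrightarrow>
        (k, compose_op A k f gs) \<in> C)"

definition clone_generated :: "'a set \<Rightarrow> 'a operation set \<Rightarrow> 'a operation set" where
  "clone_generated A F = is_clone A hull F"

definition clone_fragment :: "'a set \<Rightarrow> nat \<Rightarrow> ('a list \<Rightarrow> 'a) set \<Rightarrow> bool" where
  "clone_fragment A d N \<longleftrightarrow> N \<subseteq> ops A d \<and> N = level (clone_generated A ({d} \<times> N)) d"

text \<open>
  \<open>K\<close> is the set of (zero-based) positions of the variables of \<open>f\<close> that are kept; the variable at
  position \<open>i \<in> K\<close> becomes the variable at position \<open>u + |{k \<in> K. k < i}|\<close> of the \<open>d\<close>-ary result.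
  The constants \<open>c ! i\<close> with \<open>i \<in> K\<close> are irrelevant. The number \<open>v\<close> of appended fictitious
  variables is \<open>d - u - card K\<close>.
\<close>

definition trl :: "'a set \<Rightarrow> nat \<Rightarrow> 'a operation \<Rightarrow> ('a list \<Rightarrow> 'a) set" where
  "trl A d = (\<lambda>(n, f).
     {\<lambda>x\<in>tuples A d.
         f (map (\<lambda>i. if i \<in> K then x ! (u + card {k \<in> K. k < i}) else c ! i) [0..<n])
      | K c u. K \<subseteq> {..<n} \<and> c \<in> tuples A n \<and> u + card K \<le> d})"

definition star :: "'a set \<Rightarrow> nat \<Rightarrow> ('a list \<Rightarrow> 'a) set \<Rightarrow> 'a operation set" where
  "star A d N = {F \<in> Op A. trl A d F \<subseteq> N}"

definition const_ops :: "'a set \<Rightarrow> nat \<Rightarrow> ('a list \<Rightarrow> 'a) set" where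
  "const_ops A d = {\<lambda>x\<in>tuples A d. c | c. c \<in> A}"

definition d_closure :: "'a set \<Rightarrow> nat \<Rightarrow> ('a list \<Rightarrow> 'a) set \<Rightarrow> ('a list \<Rightarrow> 'a) set" where
  "d_closure A d M =
     \<Inter>{N. M \<union> const_ops A d \<subseteq> N \<and> clone_fragment A d N \<and> is_clone A (star A d N)}"

text \<open>The base set \<open>C\<close> is a parameter: for curried R-relations it is a set of functions.\<close>

definition ebtrl :: "'b set \<Rightarrow> nat \<Rightarrow> ('b list \<Rightarrow> 'c) \<Rightarrow> ('b list \<Rightarrow> 'c) set" where
  "ebtrl B n h = {\<lambda>x\<in>tuples B n. h (take i x @ c # drop i x) | i c. i \<le> n \<and> c \<in> B}"

definition eftrl :: "'b set \<Rightarrow> nat \<Rightarrow> ('b list \<Rightarrow> 'c) \<Rightarrow> ('b list \<Rightarrow> 'c) set" where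
  "eftrl B n g =
     {\<lambda>x\<in>tuples B (Suc n). g (tl x), \<lambda>x\<in>tuples B (Suc n). g (butlast x)}"

definition circledast :: "'c set \<Rightarrow> 'b set \<Rightarrow> nat \<Rightarrow> ('b list \<Rightarrow> 'c) set \<Rightarrow> ('b list \<Rightarrow> 'c) set" where
  "circledast C B d \<rho> = {h \<in> tuples B (Suc d) \<rightarrow>\<^sub>E C. ebtrl B d h \<subseteq> \<rho>}"

definition Delta :: "'b set \<Rightarrow> nat \<Rightarrow> ('b list \<Rightarrow> 'c) \<Rightarrow> ('b list \<Rightarrow> 'c) set" where
  "Delta B d h = {\<lambda>x\<in>tuples B d. h (take j x @ (x ! i) # drop j x) | i j. i < j \<and> j \<le> d}"

definition simple_int_reflexive :: "'c set \<Rightarrow> 'b set \<Rightarrow> nat \<Rightarrow> ('b list \<Rightarrow> 'c) set \<Rightarrow> bool" where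
  "simple_int_reflexive C B d \<rho> \<longleftrightarrow> (\<Union>g\<in>\<rho>. eftrl B d g) \<subseteq> circledast C B d \<rho>"

definition simple_transitive :: "'c set \<Rightarrow> 'b set \<Rightarrow> nat \<Rightarrow> ('b list \<Rightarrow> 'c) set \<Rightarrow> bool" where
  "simple_transitive C B d \<rho> \<longleftrightarrow> (\<Union>h\<in>circledast C B d \<rho>. Delta B d h) \<subseteq> \<rho>"

text \<open>
  The arity \<open>B\<^sub>1\<^bsup>d\<^sub>1\<^esup> \<times> \<dots> \<times> B\<^sub>s\<^bsup>d\<^sub>s\<^esup>\<close> is the list of the pairs \<open>(B\<^sub>j, d\<^sub>j)\<close>; its elements are lists of
  length \<open>s\<close> whose \<open>j\<close>-th entry lies in \<open>tuples B\<^sub>j d\<^sub>j\<close>. Factors are numbered from \<open>0\<close>.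
\<close>

type_synonym 'b arity = "('b set \<times> nat) list"

definition arity_dom :: "'b arity \<Rightarrow> 'b list list set" where
  "arity_dom \<alpha> = listset (map (\<lambda>(B, k). tuples B k) \<alpha>)"

definition dimension :: "'b arity \<Rightarrow> nat" where
  "dimension \<alpha> = sum_list (map snd \<alpha>)"

definition delete_factor :: "nat \<Rightarrow> 'b arity \<Rightarrow> 'b arity" where
  "delete_factor j \<alpha> = take j \<alpha> @ drop (Suc j) \<alpha>"

definition curry_at ::
    "'b arity \<Rightarrow> nat \<Rightarrow> ('b list list \<Rightarrow> 'a) \<Rightarrow> 'b list \<Rightarrow> 'b list list \<Rightarrow> 'a" where
  "curry_at \<alpha> j g = (\<lambda>X\<in>tuples (fst (\<alpha> ! j)) (snd (\<alpha> ! j)).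
     \<lambda>Y\<in>arity_dom (delete_factor j \<alpha>). g (take j Y @ X # drop j Y))"

definition curry_base :: "'a set \<Rightarrow> 'b arity \<Rightarrow> nat \<Rightarrow> ('b list list \<Rightarrow> 'a) set" where
  "curry_base A \<alpha> j = arity_dom (delete_factor j \<alpha>) \<rightarrow>\<^sub>E A"

definition int_reflexive :: "'a set \<Rightarrow> 'b arity \<Rightarrow> ('b list list \<Rightarrow> 'a) set \<Rightarrow> bool" where
  "int_reflexive A \<alpha> \<rho> \<longleftrightarrow> (\<forall>j<length \<alpha>.
     simple_int_reflexive (curry_base A \<alpha> j) (fst (\<alpha> ! j)) (snd (\<alpha> ! j)) (curry_at \<alpha> j ` \<rho>))"

definition transitive :: "'a set \<Rightarrow> 'b arity \<Rightarrow> ('b list list \<Rightarrow> 'a) set \<Rightarrow> bool" where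
  "transitive A \<alpha> \<rho> \<longleftrightarrow> (\<forall>j<length \<alpha>.
     simple_transitive (curry_base A \<alpha> j) (fst (\<alpha> ! j)) (snd (\<alpha> ! j)) (curry_at \<alpha> j ` \<rho>))"

definition generalized_quasiorder ::
    "'a set \<Rightarrow> 'b arity \<Rightarrow> ('b list list \<Rightarrow> 'a) set \<Rightarrow> bool" where
  "generalized_quasiorder A \<alpha> \<rho> \<longleftrightarrow>
     \<rho> \<subseteq> (arity_dom \<alpha> \<rightarrow>\<^sub>E A) \<and> int_reflexive A \<alpha> \<rho> \<and> transitive A \<alpha> \<rho> \<and>
     (\<forall>c\<in>A. (\<lambda>X\<in>arity_dom \<alpha>. c) \<in> \<rho>)"

definition preserves ::
    "nat \<Rightarrow> ('a list \<Rightarrow> 'a) \<Rightarrow> 'b arity \<Rightarrow> ('b list list \<Rightarrow> 'a) set \<Rightarrow> bool" where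
  "preserves n f \<alpha> \<rho> \<longleftrightarrow>
     (\<forall>gs\<in>tuples \<rho> n. (\<lambda>X\<in>arity_dom \<alpha>. f (map (\<lambda>g. g X) gs)) \<in> \<rho>)"

text \<open>
  As for operations, a relation is paired with its arity. Canonical arities are formed from the
  ordinals \<open>m = {0, \<dots>, m - 1}\<close>.
\<close>

type_synonym 'a canonical_relation = "nat arity \<times> (nat list list \<Rightarrow> 'a) set"

definition canonical_arity :: "nat arity \<Rightarrow> bool" where
  "canonical_arity \<alpha> \<longleftrightarrow> (\<forall>(B, k)\<in>set \<alpha>. (\<exists>m\<ge>1. B = {..<m}) \<and> 1 \<le> k)"

definition GQuord :: "nat \<Rightarrow> 'a set \<Rightarrow> 'a canonical_relation set" where
  "GQuord d A = {(\<alpha>, \<rho>). canonical_arity \<alpha> \<and> dimension \<alpha> = d \<and> generalized_quasiorder A \<alpha> \<rho>}"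

definition GQuord_inv ::
    "nat \<Rightarrow> 'a set \<Rightarrow> ('a list \<Rightarrow> 'a) set \<Rightarrow> 'a canonical_relation set" where
  "GQuord_inv d A M = {(\<alpha>, \<rho>) \<in> GQuord d A. \<forall>f\<in>M. preserves d f \<alpha> \<rho>}"

definition Pol :: "nat \<Rightarrow> 'a set \<Rightarrow> 'a canonical_relation set \<Rightarrow> ('a list \<Rightarrow> 'a) set" where
  "Pol d A T = {f \<in> ops A d. \<forall>(\<alpha>, \<rho>)\<in>T. preserves d f \<alpha> \<rho>}"

end

(*
  Inclusion from left to right: Pol^(d) of the invariant quasiorders contains M and the constants, so
  it is enough that f preserves a d-dimensional generalized quasiorder rho as soon as all its
  translations do. In f(g_1(X), ..., g_n(X)), give every g_i its own copy of the variables. If the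
  copies are filled with constants up to d_j free variables in the j-th factor, at most
  d = d_1 + ... + d_s of the g_i are non-constant, so this is a translation of f applied to members
  of rho (which is closed under such fillings by internal reflexivity). Transitivity then identifies
  the copies, one variable and one factor at a time.

  Inclusion from right to left: a clone fragment N with constants such that N^* is a clone is itself
  a generalized quasiorder of arity A^d, and the d-ary operations preserving it are those in N
  (apply them to the projections).
*)

theory Submission
  imports Defs
begin

text \<open>Transitivity speaks of \<open>d + 1\<close> variables only, and asks about every way of
  fixing one of them, whereas the composite with separate copies has \<open>n\<close> times
  \<open>d_j\<close> variables in factor \<open>j\<close>. The assumption carried along therefore
  covers all fillings that leave exactly \<open>d_j\<close> variables free: fixing one more
  coordinate gives a composite of the same kind with fewer surplus coordinates, so an induction on
  their number closes. A filling uses its free variables in order, hence the copy belonging to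
  \<open>g_i\<close> reads an interval of them; as a function of all \<open>d_j\<close> variables it
  is \<open>g_i\<close> with some constants and with fictitious variables on both sides, which is
  where internal reflexivity enters. That \<open>Pol\<close> of the invariant quasiorders is one of
  the sets \<open>N\<close> in the intersection also requires its star to be a clone. The star turns
  out to be the clone of polymorphisms of all arities: one half is the statement about translations,
  the other holds since translations are compositions with projections and constants.\<close>

section \<open>Tuples, and tuples with holes\<close>

lemma tuples_length: "x \<in> tuples B n \<Longrightarrow> length x = n"
  by (simp add: tuples_def)

lemma tuples_nth: "x \<in> tuples B n \<Longrightarrow> i < n \<Longrightarrow> x ! i \<in> B"
  by (auto simp: tuples_def)

lemma tuples_insert: "x \<in> tuples B n \<Longrightarrow> c \<in> B \<Longrightarrow> take i x @ c # drop i x \<in> tuples B (Suc n)"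
  by (auto simp: tuples_def dest: in_set_takeD in_set_dropD)

text \<open>The entries \<open>None\<close> are holes, which receive the entries of \<open>x\<close>
  from left to right. Surplus entries of \<open>x\<close> are ignored, which expresses trailing
  fictitious variables; \<open>hd\<close> of an empty list is reached only when there are more holes
  than entries.\<close>

fun fill :: "'b option list \<Rightarrow> 'b list \<Rightarrow> 'b list" where
  "fill [] x = []"
| "fill (Some c # p) x = c # fill p x"
| "fill (None # p) x = hd x # fill p (tl x)"

definition patterns :: "'b set \<Rightarrow> nat \<Rightarrow> 'b option list set" where
  "patterns B n = tuples (insert None (Some ` B)) n"

lemma patterns_length: "p \<in> patterns B n \<Longrightarrow> length p = n"
  by (simp add: patterns_def tuples_def)

lemma patterns_insert:
  "p \<in> patterns B n \<Longrightarrow> c \<in> B \<Longrightarrow> take i p @ Some c # drop i p \<in> patterns B (Suc n)"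
  unfolding patterns_def by (rule tuples_insert) auto

lemma length_fill [simp]: "length (fill p x) = length p"
  by (induction p x rule: fill.induct) auto

lemma set_fill:
  "\<lbrakk>set p \<subseteq> insert None (Some ` B); set x \<subseteq> B; count_list p None \<le> length x\<rbrakk> \<Longrightarrow> set (fill p x) \<subseteq> B"
proof (induction p x rule: fill.induct)
  case (3 p x)
  then show ?case by (cases x) auto
qed auto

lemma fill_in_tuples:
  "\<lbrakk>p \<in> patterns B n; set x \<subseteq> B; count_list p None \<le> length x\<rbrakk> \<Longrightarrow> fill p x \<in> tuples B n"
  using set_fill[of p B x] by (auto simp: patterns_def tuples_def)

lemma fill_append: "fill (p @ q) x = fill p x @ fill q (drop (count_list p None) x)"
  by (induction p x rule: fill.induct) (auto simp: drop_Suc)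

lemma insert_fill:
  "take i (fill p x) @ c # drop i (fill p x) = fill (take i p @ Some c # drop i p) x"
proof (induction p x arbitrary: i rule: fill.induct)
  case (2 b p x)
  then show ?case by (cases i) auto
next
  case (3 p x)
  then show ?case by (cases i) auto
qed auto

lemma fill_replicate_None: "fill (replicate (length x) None) x = x"
  by (induction x) auto

lemma fill_take: "count_list p None \<le> m \<Longrightarrow> m \<le> length x \<Longrightarrow> fill p (take m x) = fill p x"
proof (induction p x arbitrary: m rule: fill.induct)
  case (3 p x)
  then show ?case by (cases x; cases m) auto
qed auto

lemma fill_cong_None: "None \<notin> set p \<Longrightarrow> fill p x = fill p y"
  by (induction p x rule: fill.induct) auto

text \<open>The hole behind \<open>p\<close> is preceded by \<open>count_list p None\<close> holes,
  so a value inserted into the argument at that position meets exactly this hole. Thus closing a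
  hole by a constant becomes the operation that \<open>ebtrl\<close> performs.\<close>

lemma fill_insert_arg:
  "count_list p None \<le> length x \<Longrightarrow>
   fill (p @ None # q) (take (count_list p None) x @ c # drop (count_list p None) x)
     = fill (p @ Some c # q) x"
proof (induction p x rule: fill.induct)
  case (3 p x)
  then show ?case by (cases x) auto
qed auto

lemma count_list_eq_length: "count_list xs a = length xs \<longleftrightarrow> xs = replicate (length xs) a"
proof (induction xs)
  case (Cons b xs)
  then show ?case using count_le_length[of xs a] by auto
qed simp

section \<open>Identification of variables and filling for relations of simple arity\<close>

text \<open>
  An entry \<open>Inl i\<close> of \<open>I\<close> asks for a copy of the variable \<open>i\<close>, an entry \<open>Inr c\<close> for the constant
  \<open>c\<close>; constants arise in the induction when a variable that has copies is fixed.
\<close>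

lemma transitive_diagonal:
  fixes B :: "'b set"
  assumes trans: "simple_transitive C B d \<sigma>"
    and "k \<in> tuples B (d + length I) \<rightarrow> C"
    and "\<And>p. p \<in> patterns B (d + length I) \<Longrightarrow> count_list p None = d \<Longrightarrow>
                  (\<lambda>x\<in>tuples B d. k (fill p x)) \<in> \<sigma>"
    and "set I \<subseteq> Inl ` {..<d} \<union> Inr ` B"
  shows "(\<lambda>x\<in>tuples B d. k (x @ map (case_sum ((!) x) id) I)) \<in> \<sigma>"
  using assms(2-)
proof (induction "length I" arbitrary: I k)
  case 0
  have "count_list (replicate n None) None = n" for n
    by (induction n) auto
  then have "(\<lambda>x\<in>tuples B d. k (fill (replicate d None) x)) \<in> \<sigma>"
    using 0(1) by (intro 0(3)) (auto simp: patterns_def tuples_def)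
  also have "(\<lambda>x\<in>tuples B d. k (fill (replicate d None) x)) = (\<lambda>x\<in>tuples B d. k x)"
    by (rule restrict_ext) (metis fill_replicate_None tuples_length)
  finally show ?case using 0 by simp
next
  case (Suc m)
  then obtain a I' where I: "I = a # I'" and m: "m = length I'"
    by (cases I) auto
  \<comment> \<open>With coordinate \<open>t\<close> fixed, \<open>k\<close> has one coordinate
    less, and the induction hypothesis applies for any \<open>J\<close> of length \<open>m\<close>:
    a filling of the new function is a filling of \<open>k\<close> with one more constant, so the
    number of holes is still \<open>d\<close>.\<close>
  have step: "(\<lambda>x\<in>tuples B d. k (take t x @ c # drop t x @ map (case_sum ((!) x) id) J)) \<in> \<sigma>"
    if t: "t \<le> d" and c: "c \<in> B" and J: "set J \<subseteq> Inl ` {..<d} \<union> Inr ` B" and len: "length J = m"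
    for t c J
  proof -
    have "(\<lambda>x\<in>tuples B d. (\<lambda>z. k (take t z @ c # drop t z)) (x @ map (case_sum ((!) x) id) J)) \<in> \<sigma>"
    proof (rule Suc.hyps(1)[OF len[symmetric] _ _ J])
      show "(\<lambda>z. k (take t z @ c # drop t z)) \<in> tuples B (d + length J) \<rightarrow> C"
        using Suc.prems(1) tuples_insert[OF _ c] len I m by fastforce
      fix p assume p: "p \<in> patterns B (d + length J)" "count_list p None = d"
      have "count_list (take t p @ Some c # drop t p) None = count_list (take t p @ drop t p) None"
        unfolding count_list_append by simp
      then have "count_list (take t p @ Some c # drop t p) None = d"
        using p by simp
      from Suc.prems(2)[OF _ this] patterns_insert[OF p(1) c, of t] len I m
      show "(\<lambda>x\<in>tuples B d. k (take t (fill p x) @ c # drop t (fill p x))) \<in> \<sigma>"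
        by (simp add: insert_fill)
    qed
    also have "(\<lambda>x\<in>tuples B d. (\<lambda>z. k (take t z @ c # drop t z)) (x @ map (case_sum ((!) x) id) J))
      = (\<lambda>x\<in>tuples B d. k (take t x @ c # drop t x @ map (case_sum ((!) x) id) J))"
      by (rule restrict_ext) (use t in \<open>auto dest: tuples_length\<close>)
    finally show ?thesis .
  qed
  show ?case
  proof (cases a)
    \<comment> \<open>The constant sits in coordinate \<open>d\<close>, the first one behind the
      free variables.\<close>
    case (Inr c)
    have "(\<lambda>x\<in>tuples B d. k (take d x @ c # drop d x @ map (case_sum ((!) x) id) I')) \<in> \<sigma>"
      using Suc.prems(3) Inr by (intro step) (auto simp: I m)
    also have "(\<lambda>x\<in>tuples B d. k (take d x @ c # drop d x @ map (case_sum ((!) x) id) I'))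
       = (\<lambda>x\<in>tuples B d. k (x @ map (case_sum ((!) x) id) I))"
      by (rule restrict_ext) (auto dest: tuples_length simp: I Inr)
    finally show ?thesis .
  next
    case (Inl i)
    with Suc.prems(3) have i: "i < d" by (auto simp: I)
    \<comment> \<open>The copy of variable \<open>i\<close> is kept apart as the new last variable
      of \<open>h\<close>, while \<open>I'\<close> still refers to the first \<open>d\<close>
      variables. Fixing any variable of \<open>h\<close> falls under \<open>step\<close>, and
      transitivity then identifies the variables \<open>i\<close> and \<open>d\<close>.\<close>
    define h where "h = (\<lambda>z\<in>tuples B (Suc d). k (z @ map (case_sum ((!) (take d z)) id) I'))"
    have I': "set I' \<subseteq> Inl ` {..<d} \<union> Inr ` B" using Suc.prems(3) by (auto simp: I)
    have ev: "set (map (case_sum ((!) x) id) J) \<subseteq> B"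
      if "set J \<subseteq> Inl ` {..<d} \<union> Inr ` B" "length x \<ge> d" "set x \<subseteq> B" for x and J :: "(nat + 'b) list"
      using that by (fastforce simp: subset_iff)
    have "h \<in> circledast C B d \<sigma>"
      unfolding circledast_def
    proof (intro CollectI conjI)
      show "h \<in> tuples B (Suc d) \<rightarrow>\<^sub>E C"
        unfolding h_def
      proof (rule restrict_PiE_iff[THEN iffD2], intro ballI)
        fix z assume z: "z \<in> tuples B (Suc d)"
        have "set (map (case_sum ((!) (take d z)) id) I') \<subseteq> B"
          using z by (intro ev I') (auto simp: tuples_def dest: in_set_takeD)
        with z have "z @ map (case_sum ((!) (take d z)) id) I' \<in> tuples B (d + length I)"
          by (auto simp: tuples_def I)
        with Suc.prems(1) show "k (z @ map (case_sum ((!) (take d z)) id) I') \<in> C" by auto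
      qed
      show "ebtrl B d h \<subseteq> \<sigma>"
      proof
        fix e assume "e \<in> ebtrl B d h"
        then obtain t c where t: "t \<le> d" and c: "c \<in> B"
          and e: "e = (\<lambda>x\<in>tuples B d. h (take t x @ c # drop t x))"
          by (auto simp: ebtrl_def)
        \<comment> \<open>Once variable \<open>t\<close> is fixed at \<open>c\<close>, its copies
          become the constant \<open>c\<close> and the later variables move down by one.\<close>
        define J where "J = map (case_sum (\<lambda>j. if j < t then Inl j else if j = t then Inr c else Inl (j - 1)) Inr) I'"
        have "(\<lambda>x\<in>tuples B d. k (take t x @ c # drop t x @ map (case_sum ((!) x) id) J)) \<in> \<sigma>"
        proof (intro step t c)
          show "set J \<subseteq> Inl ` {..<d} \<union> Inr ` B"
          proof
            fix b assume "b \<in> set J"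
            then obtain a where "a \<in> set I'"
              and b: "b = case_sum (\<lambda>j. if j < t then Inl j else if j = t then Inr c else Inl (j - 1)) Inr a"
              by (auto simp: J_def)
            with I' have "a \<in> Inl ` {..<d} \<union> Inr ` B" by blast
            with c show "b \<in> Inl ` {..<d} \<union> Inr ` B" unfolding b by (auto simp: less_imp_diff_less)
          qed
        qed (simp add: J_def m)
        also have "(\<lambda>x\<in>tuples B d. k (take t x @ c # drop t x @ map (case_sum ((!) x) id) J)) = e"
          unfolding e
        proof (rule restrict_ext)
          fix x assume x: "x \<in> tuples B d"
          have "map (case_sum ((!) x) id) J
              = map (case_sum ((!) (take d (take t x @ c # drop t x))) id) I'"
            using I' t tuples_length[OF x]
            by (auto simp: J_def nth_append nth_Cons' min_def)
          then show "k (take t x @ c # drop t x @ map (case_sum ((!) x) id) J)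
              = h (take t x @ c # drop t x)"
            using tuples_insert[OF x c, of t] by (simp add: h_def)
        qed
        finally show "e \<in> \<sigma>" .
      qed
    qed
    then have "(\<lambda>x\<in>tuples B d. h (take d x @ (x ! i) # drop d x)) \<in> \<sigma>"
      using trans i by (auto simp: simple_transitive_def Delta_def)
    also have "(\<lambda>x\<in>tuples B d. h (take d x @ (x ! i) # drop d x))
        = (\<lambda>x\<in>tuples B d. k (x @ map (case_sum ((!) x) id) I))"
    proof (rule restrict_ext)
      fix x assume x: "x \<in> tuples B d"
      have "take d x @ x ! i # drop d x \<in> tuples B (Suc d)"
        using x i tuples_nth by (metis tuples_insert)
      then show "h (take d x @ (x ! i) # drop d x) = k (x @ map (case_sum ((!) x) id) I)"
        using tuples_length[OF x] by (simp add: h_def I Inl)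
    qed
    finally show ?thesis .
  qed
qed

text \<open>Induction on the number of constants in \<open>p\<close>. A filling with one constant
  less receives a fictitious variable by \<open>eftrl\<close>; since the result lies in
  \<open>circledast\<close>, one of its \<open>d + 1\<close> variables may be replaced by the
  constant, which restores the arity \<open>d\<close>. The offset \<open>u\<close> counts leading
  fictitious variables.\<close>

lemma reflexive_fill:
  assumes refl: "simple_int_reflexive C B d \<sigma>" and "\<sigma> \<subseteq> tuples B d \<rightarrow>\<^sub>E C" and "g \<in> \<sigma>"
    and "p \<in> patterns B d" and "u + count_list p None \<le> d"
  shows "(\<lambda>x\<in>tuples B d. g (fill p (drop u x))) \<in> \<sigma>"
  using assms(3-)
proof (induction "d - count_list p None" arbitrary: p u)
  case 0
  then have "count_list p None = length p" "length p = d"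
    using count_le_length[of p None] patterns_length[of p B d] by linarith+
  then have p: "p = replicate d None"
    using count_list_eq_length[of p None] by simp
  have "u = 0" using 0 \<open>count_list p None = length p\<close> \<open>length p = d\<close> by simp
  then have "(\<lambda>x\<in>tuples B d. g (fill p (drop u x))) = restrict g (tuples B d)"
    by (intro restrict_ext) (metis fill_replicate_None drop0 p tuples_length)
  also have "\<dots> = g" using 0(2) assms(2) by (metis PiE_restrict subsetD)
  finally show ?case using 0 by simp
next
  case (Suc s)
  have "\<not> (\<forall>a\<in>set p. a = None)"
  proof
    assume "\<forall>a\<in>set p. a = None"
    then have "count_list p None = length p" by (induction p) auto
    then show False using Suc(2) patterns_length[OF Suc(4)] by simp
  qed
  then have "\<exists>p1 c p2. p = p1 @ Some c # p2"
    by (metis not_None_eq split_list)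
  then obtain p1 c p2 where p: "p = p1 @ Some c # p2" by blast
  \<comment> \<open>One constant of \<open>p\<close> is reopened as a hole. The number
    \<open>?t\<close> of holes before it is, up to the offset, the position of the argument at which
    \<open>c\<close> has to be inserted.\<close>
  let ?q = "p1 @ None # p2" and ?t = "count_list p1 None"
  have c: "c \<in> B" using Suc.prems(2) p by (auto simp: patterns_def tuples_def)
  have q: "?q \<in> patterns B d" "count_list ?q None = Suc (count_list p None)"
    using Suc.prems(2) by (auto simp: patterns_def tuples_def p)
  have le: "?t \<le> count_list p None" by (simp add: p)
  have ins: "(\<lambda>x\<in>tuples B d. e (take i x @ c # drop i x)) \<in> \<sigma>"
    if "e \<in> eftrl B d \<gamma>" "\<gamma> \<in> \<sigma>" "i \<le> d" for e \<gamma> i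
  proof -
    have "e \<in> circledast C B d \<sigma>"
      using refl that by (auto simp: simple_int_reflexive_def)
    then show ?thesis using that c by (auto simp: circledast_def ebtrl_def)
  qed
  have d: "count_list p None < d" using Suc by linarith
  show ?case
  proof (cases u)
    \<comment> \<open>Without leading fictitious variables the new one is appended. In the other
      case it is prepended, which raises the offset from \<open>v\<close> to
      \<open>u\<close>.\<close>
    case 0
    define \<gamma> where "\<gamma> = (\<lambda>x\<in>tuples B d. g (fill ?q (drop 0 x)))"
    have "\<gamma> \<in> \<sigma>" unfolding \<gamma>_def
      using Suc.hyps(2) Suc.prems(1) q d by (intro Suc.hyps(1)) auto
    then have "(\<lambda>x\<in>tuples B d. (\<lambda>y\<in>tuples B (Suc d). \<gamma> (butlast y)) (take ?t x @ c # drop ?t x)) \<in> \<sigma>"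
      using le d by (intro ins) (auto simp: eftrl_def)
    also have "(\<lambda>x\<in>tuples B d. (\<lambda>y\<in>tuples B (Suc d). \<gamma> (butlast y)) (take ?t x @ c # drop ?t x))
      = (\<lambda>x\<in>tuples B d. g (fill p (drop u x)))"
    proof (rule restrict_ext)
      fix x assume x: "x \<in> tuples B d"
      note l = tuples_length[OF x]
      let ?y = "take ?t x @ c # drop ?t x"
      have y: "?y \<in> tuples B (Suc d)" using tuples_insert[OF x c] .
      have "butlast ?y \<in> tuples B d"
        using y in_set_butlastD[of _ ?y] unfolding tuples_def by auto
      moreover have "fill ?q (butlast ?y) = fill p x"
        using q(2) d l fill_insert_arg[of p1 x p2 c] le fill_take[of ?q d ?y]
        unfolding p[symmetric] butlast_conv_take by simp
      ultimately show "(\<lambda>y\<in>tuples B (Suc d). \<gamma> (butlast y)) ?y = g (fill p (drop u x))"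
        using y 0 by (simp add: \<gamma>_def)
    qed
    finally show ?thesis .
  next
    case (Suc v)
    define \<gamma> where "\<gamma> = (\<lambda>x\<in>tuples B d. g (fill ?q (drop v x)))"
    have "\<gamma> \<in> \<sigma>" unfolding \<gamma>_def
      using Suc.hyps(2) Suc.prems q d Suc by (intro Suc.hyps(1)) auto
    then have "(\<lambda>x\<in>tuples B d. (\<lambda>y\<in>tuples B (Suc d). \<gamma> (tl y)) (take (u + ?t) x @ c # drop (u + ?t) x)) \<in> \<sigma>"
      using le Suc.prems by (intro ins) (auto simp: eftrl_def)
    also have "(\<lambda>x\<in>tuples B d. (\<lambda>y\<in>tuples B (Suc d). \<gamma> (tl y)) (take (u + ?t) x @ c # drop (u + ?t) x))
      = (\<lambda>x\<in>tuples B d. g (fill p (drop u x)))"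
    proof (rule restrict_ext)
      fix x assume x: "x \<in> tuples B d"
      note l = tuples_length[OF x]
      let ?y = "take (u + ?t) x @ c # drop (u + ?t) x"
      have y: "?y \<in> tuples B (Suc d)" using tuples_insert[OF x c] .
      have "tl ?y \<in> tuples B d" using y by (cases ?y) (auto simp: tuples_def dest: list.set_sel(2))
      moreover have "drop v (tl ?y) = take ?t (drop u x) @ c # drop ?t (drop u x)"
        using l Suc Suc.prems(3) le by (simp add: drop_Suc[symmetric] take_drop add.commute)
      moreover have "fill ?q (take ?t (drop u x) @ c # drop ?t (drop u x)) = fill p (drop u x)"
        using Suc.prems(3) le l by (subst fill_insert_arg) (auto simp: p)
      ultimately show "(\<lambda>y\<in>tuples B (Suc d). \<gamma> (tl y)) ?y = g (fill p (drop u x))"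
        using y by (simp add: \<gamma>_def)
    qed
    finally show ?thesis .
  qed
qed

section \<open>Arities with several factors, and currying at one of them\<close>

lemma arity_dom_iff_list_all2:
  "X \<in> arity_dom \<alpha> \<longleftrightarrow> list_all2 (\<lambda>Z (B, k). Z \<in> tuples B k) X \<alpha>"
proof (induction \<alpha> arbitrary: X)
  case Nil
  then show ?case by (simp add: arity_dom_def)
next
  case (Cons a \<alpha>)
  then show ?case
    by (cases a; cases X) (auto simp: arity_dom_def set_Cons_def)
qed

lemma arity_dom_iff:
  "X \<in> arity_dom \<alpha> \<longleftrightarrow>
     length X = length \<alpha> \<and> (\<forall>j<length \<alpha>. X ! j \<in> tuples (fst (\<alpha> ! j)) (snd (\<alpha> ! j)))"
  by (auto simp: arity_dom_iff_list_all2 list_all2_conv_all_nth case_prod_unfold)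

lemma arity_dom_update:
  assumes "X \<in> arity_dom \<alpha>" "Z \<in> tuples (fst (\<alpha> ! j)) (snd (\<alpha> ! j))"
  shows "X[j := Z] \<in> arity_dom \<alpha>"
  unfolding arity_dom_iff
proof (intro conjI allI impI)
  fix i assume "i < length \<alpha>"
  then show "X[j := Z] ! i \<in> tuples (fst (\<alpha> ! i)) (snd (\<alpha> ! i))"
    using assms by (cases "i = j") (auto simp: arity_dom_iff)
qed (use assms in \<open>simp add: arity_dom_iff\<close>)

lemma arity_dom_delete:
  "X \<in> arity_dom \<alpha> \<Longrightarrow> take j X @ drop (Suc j) X \<in> arity_dom (delete_factor j \<alpha>)"
  unfolding arity_dom_iff_list_all2 delete_factor_def
  by (intro list_all2_appendI list_all2_takeI list_all2_dropI)

lemma arity_dom_insert: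
  assumes "j < length \<alpha>" "Y \<in> arity_dom (delete_factor j \<alpha>)"
    "Z \<in> tuples (fst (\<alpha> ! j)) (snd (\<alpha> ! j))"
  shows "take j Y @ Z # drop j Y \<in> arity_dom \<alpha>"
proof -
  let ?P = "\<lambda>Z (B, k). Z \<in> tuples B k"
  have Y: "list_all2 ?P Y (take j \<alpha> @ drop (Suc j) \<alpha>)"
    using assms(2) by (simp add: arity_dom_iff_list_all2 delete_factor_def)
  have "list_all2 ?P (take j Y) (take j \<alpha>)" "list_all2 ?P (drop j Y) (drop (Suc j) \<alpha>)"
    using list_all2_takeI[OF Y, of j] list_all2_dropI[OF Y, of j] assms(1) by simp_all
  then have "list_all2 ?P (take j Y @ Z # drop j Y) (take j \<alpha> @ \<alpha> ! j # drop (Suc j) \<alpha>)"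
    using assms(3) by (intro list_all2_appendI) (auto simp: case_prod_unfold)
  then show ?thesis
    using id_take_nth_drop[OF assms(1)] by (simp add: arity_dom_iff_list_all2)
qed

lemma arity_dom_delete_length:
  "j < length \<alpha> \<Longrightarrow> Y \<in> arity_dom (delete_factor j \<alpha>) \<Longrightarrow> Suc (length Y) = length \<alpha>"
  by (auto simp: arity_dom_iff delete_factor_def)

lemma curry_at_apply:
  assumes "X \<in> arity_dom \<alpha>" "j < length \<alpha>"
  shows "curry_at \<alpha> j g (X ! j) (take j X @ drop (Suc j) X) = g X"
proof -
  have "length X = length \<alpha>" "X ! j \<in> tuples (fst (\<alpha> ! j)) (snd (\<alpha> ! j))"
    using assms by (auto simp: arity_dom_iff)
  then show ?thesis
    using assms arity_dom_delete[OF assms(1), of j] id_take_nth_drop[of j X]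
    by (simp add: curry_at_def)
qed

lemma curry_at_inject:
  assumes "curry_at \<alpha> j g = curry_at \<alpha> j g'" "j < length \<alpha>"
    "g \<in> arity_dom \<alpha> \<rightarrow>\<^sub>E A" "g' \<in> arity_dom \<alpha> \<rightarrow>\<^sub>E A"
  shows "g = g'"
proof (rule PiE_ext[OF assms(3,4)])
  fix X assume "X \<in> arity_dom \<alpha>"
  then show "g X = g' X"
    using curry_at_apply[of X \<alpha> j g] curry_at_apply[of X \<alpha> j g'] assms(1,2) by simp
qed

lemma curry_at_in_PiE:
  assumes "g \<in> arity_dom \<alpha> \<rightarrow>\<^sub>E A" "j < length \<alpha>"
  shows "curry_at \<alpha> j g \<in> tuples (fst (\<alpha> ! j)) (snd (\<alpha> ! j)) \<rightarrow>\<^sub>E curry_base A \<alpha> j"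
  using assms arity_dom_insert[of j \<alpha>] by (auto simp: curry_at_def curry_base_def)

lemma curry_at_imageD:
  assumes "curry_at \<alpha> j g \<in> curry_at \<alpha> j ` \<rho>" "j < length \<alpha>" "\<rho> \<subseteq> arity_dom \<alpha> \<rightarrow>\<^sub>E A"
    "g \<in> arity_dom \<alpha> \<rightarrow>\<^sub>E A"
  shows "g \<in> \<rho>"
  using assms curry_at_inject by blast

lemma generalized_quasiorderD:
  assumes "generalized_quasiorder A \<alpha> \<rho>"
  shows "\<rho> \<subseteq> arity_dom \<alpha> \<rightarrow>\<^sub>E A"
    and "j < length \<alpha> \<Longrightarrow>
      simple_int_reflexive (curry_base A \<alpha> j) (fst (\<alpha> ! j)) (snd (\<alpha> ! j)) (curry_at \<alpha> j ` \<rho>)"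
    and "j < length \<alpha> \<Longrightarrow>
      simple_transitive (curry_base A \<alpha> j) (fst (\<alpha> ! j)) (snd (\<alpha> ! j)) (curry_at \<alpha> j ` \<rho>)"
    and "c \<in> A \<Longrightarrow> (\<lambda>X\<in>arity_dom \<alpha>. c) \<in> \<rho>"
  using assms by (auto simp: generalized_quasiorder_def int_reflexive_def transitive_def)

section \<open>Filling in all factors of a generalized quasiorder\<close>

text \<open>This is \<open>reflexive_fill\<close> for the relation curried at factor
  \<open>j\<close>. Since currying is injective, the result can be read back as a member of the
  original relation.\<close>

lemma gquord_fill_factor:
  assumes \<rho>: "generalized_quasiorder A \<alpha> \<rho>" and g: "g \<in> \<rho>" and j: "j < length \<alpha>"
    and p: "p \<in> patterns (fst (\<alpha> ! j)) (snd (\<alpha> ! j))" and u: "u + count_list p None \<le> snd (\<alpha> ! j)"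
  shows "(\<lambda>X\<in>arity_dom \<alpha>. g (X[j := fill p (drop u (X ! j))])) \<in> \<rho>"
proof (rule curry_at_imageD[OF _ j generalized_quasiorderD(1)[OF \<rho>]])
  let ?B = "fst (\<alpha> ! j)" and ?d = "snd (\<alpha> ! j)" and ?\<phi> = "\<lambda>x. fill p (drop u x)"
  let ?g = "\<lambda>X\<in>arity_dom \<alpha>. g (X[j := ?\<phi> (X ! j)])"
  have gE: "g \<in> arity_dom \<alpha> \<rightarrow>\<^sub>E A"
    using generalized_quasiorderD(1)[OF \<rho>] g by blast
  have \<phi>: "?\<phi> x \<in> tuples ?B ?d" if "x \<in> tuples ?B ?d" for x
    using that u set_drop_subset[of u x] by (intro fill_in_tuples p) (auto simp: tuples_def)
  have upd: "X[j := ?\<phi> (X ! j)] \<in> arity_dom \<alpha>" if "X \<in> arity_dom \<alpha>" for X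
    using that \<phi> j by (intro arity_dom_update) (auto simp: arity_dom_iff)
  show "?g \<in> arity_dom \<alpha> \<rightarrow>\<^sub>E A"
    using gE upd by auto
  have "(\<lambda>x\<in>tuples ?B ?d. curry_at \<alpha> j g (?\<phi> x)) \<in> curry_at \<alpha> j ` \<rho>"
    using generalized_quasiorderD(1)[OF \<rho>] g
    by (intro reflexive_fill[OF generalized_quasiorderD(2)[OF \<rho> j] _ _ p u])
       (auto intro!: curry_at_in_PiE j)
  also have "(\<lambda>x\<in>tuples ?B ?d. curry_at \<alpha> j g (?\<phi> x)) = curry_at \<alpha> j ?g"
    unfolding curry_at_def
  proof (intro restrict_ext)
    fix x assume x: "x \<in> tuples ?B ?d"
    have "(\<lambda>Y\<in>arity_dom (delete_factor j \<alpha>). g (take j Y @ ?\<phi> x # drop j Y)) =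
          (\<lambda>Y\<in>arity_dom (delete_factor j \<alpha>). ?g (take j Y @ x # drop j Y))"
    proof (intro restrict_ext)
      fix Y assume Y: "Y \<in> arity_dom (delete_factor j \<alpha>)"
      then have "length (take j Y) = j"
        using arity_dom_delete_length[OF j Y] j by simp
      then show "g (take j Y @ ?\<phi> x # drop j Y) = ?g (take j Y @ x # drop j Y)"
        using arity_dom_insert[OF j Y x] by (simp add: list_update_append nth_append)
    qed
    then show "(\<lambda>X\<in>tuples ?B ?d. \<lambda>Y\<in>arity_dom (delete_factor j \<alpha>). g (take j Y @ X # drop j Y)) (?\<phi> x) =
          (\<lambda>Y\<in>arity_dom (delete_factor j \<alpha>). ?g (take j Y @ x # drop j Y))"
      using \<phi>[OF x] by simp
  qed
  finally show "curry_at \<alpha> j ?g \<in> curry_at \<alpha> j ` \<rho>" .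
qed

lemma gquord_fill:
  assumes \<rho>: "generalized_quasiorder A \<alpha> \<rho>" and g: "g \<in> \<rho>"
    and p: "\<And>j. j < length \<alpha> \<Longrightarrow> p j \<in> patterns (fst (\<alpha> ! j)) (snd (\<alpha> ! j))"
    and u: "\<And>j. j < length \<alpha> \<Longrightarrow> u j + count_list (p j) None \<le> snd (\<alpha> ! j)"
  shows "(\<lambda>X\<in>arity_dom \<alpha>. g (map (\<lambda>j. fill (p j) (drop (u j) (X ! j))) [0..<length \<alpha>])) \<in> \<rho>"
proof -
  \<comment> \<open>The factors are filled one at a time, so that passing from \<open>m\<close> to
    \<open>Suc m\<close> is an instance of \<open>gquord_fill_factor\<close>.\<close>
  let ?G = "\<lambda>m. \<lambda>X\<in>arity_dom \<alpha>.
      g (map (\<lambda>j. if j < m then fill (p j) (drop (u j) (X ! j)) else X ! j) [0..<length \<alpha>])"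
  have "?G m \<in> \<rho>" if "m \<le> length \<alpha>" for m
    using that
  proof (induction m)
    case 0
    have "?G 0 = restrict g (arity_dom \<alpha>)"
    proof (intro restrict_ext)
      fix X assume "X \<in> arity_dom \<alpha>"
      then show "g (map (\<lambda>j. if j < 0 then fill (p j) (drop (u j) (X ! j)) else X ! j) [0..<length \<alpha>]) = g X"
        using map_nth[of X] by (simp add: arity_dom_iff)
    qed
    also have "\<dots> = g"
      using generalized_quasiorderD(1)[OF \<rho>] g by (metis PiE_restrict subsetD)
    finally show ?case using g by simp
  next
    case (Suc m)
    then have m: "m < length \<alpha>" by simp
    have "(\<lambda>X\<in>arity_dom \<alpha>. ?G m (X[m := fill (p m) (drop (u m) (X ! m))])) \<in> \<rho>"
      using Suc m by (intro gquord_fill_factor[OF \<rho>] p u) auto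
    also have "(\<lambda>X\<in>arity_dom \<alpha>. ?G m (X[m := fill (p m) (drop (u m) (X ! m))])) = ?G (Suc m)"
    proof (intro restrict_ext)
      fix X assume X: "X \<in> arity_dom \<alpha>"
      let ?Y = "X[m := fill (p m) (drop (u m) (X ! m))]"
      have "set (drop (u m) (X ! m)) \<subseteq> fst (\<alpha> ! m)" "length (X ! m) = snd (\<alpha> ! m)"
        using X m by (auto simp: arity_dom_iff tuples_def dest!: in_set_dropD)
      then have "fill (p m) (drop (u m) (X ! m)) \<in> tuples (fst (\<alpha> ! m)) (snd (\<alpha> ! m))"
        using p[OF m] u[OF m] by (intro fill_in_tuples) auto
      then have "?Y \<in> arity_dom \<alpha>"
        using X by (simp add: arity_dom_update)
      moreover have "map (\<lambda>j. if j < m then fill (p j) (drop (u j) (?Y ! j)) else ?Y ! j) [0..<length \<alpha>]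
        = map (\<lambda>j. if j < Suc m then fill (p j) (drop (u j) (X ! j)) else X ! j) [0..<length \<alpha>]"
        using X m by (auto simp: arity_dom_iff nth_list_update less_Suc_eq)
      ultimately show "?G m ?Y
        = g (map (\<lambda>j. if j < Suc m then fill (p j) (drop (u j) (X ! j)) else X ! j) [0..<length \<alpha>])"
        by (simp only: restrict_apply if_True)
    qed
    finally show ?case .
  qed
  then have "?G (length \<alpha>) \<in> \<rho>" by simp
  also have "?G (length \<alpha>)
      = (\<lambda>X\<in>arity_dom \<alpha>. g (map (\<lambda>j. fill (p j) (drop (u j) (X ! j))) [0..<length \<alpha>]))"
    by (intro restrict_ext arg_cong[where f = g]) auto
  finally show ?thesis .
qed

section \<open>From preservation by the translations to preservation by the operation\<close>

text \<open>A list of length \<open>n * d\<close> is read as \<open>n\<close> consecutive copies of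
  a \<open>d\<close>-tuple; copy \<open>i\<close> is the one fed to the \<open>i\<close>-th member
  of the relation.\<close>

definition block :: "nat \<Rightarrow> nat \<Rightarrow> 'b list \<Rightarrow> 'b list" where
  "block d i z = take d (drop (i * d) z)"

lemma block_split: "p = take (i * d) p @ block d i p @ drop d (drop (i * d) p)"
  unfolding block_def by (metis append_take_drop_id)

lemma block_length:
  assumes "length z = n * d" "i < n"
  shows "length (block d i z) = d"
proof -
  have "i * d + d \<le> n * d"
    using assms(2) by (metis Suc_leI add.commute mult_Suc mult_le_mono1)
  then show ?thesis using assms(1) by (simp add: block_def)
qed

lemma block_in_tuples: "z \<in> tuples B (n * d) \<Longrightarrow> i < n \<Longrightarrow> block d i z \<in> tuples B d"
  using block_length[of z n d i]
  by (auto simp: tuples_def block_def dest!: in_set_takeD in_set_dropD)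

text \<open>The holes before block \<open>i\<close> consume an initial piece of \<open>x\<close>, so
  the block sees \<open>x\<close> shifted by their number. This shift is the origin of the offset
  \<open>u\<close> in the lemmas on filling.\<close>

lemma block_fill:
  fixes p :: "'b option list"
  assumes "length p = n * d" "i < n"
  shows "block d i (fill p x) = fill (block d i p) (drop (count_list (take (i * d) p) None) x)"
proof -
  have l: "length (take (i * d) p) = i * d" "length (block d i p) = d"
    using assms block_length[OF assms] by (auto simp: min_def)
  have "fill p x = fill (take (i * d) p) x @
      fill (block d i p) (drop (count_list (take (i * d) p) None) x) @
      fill (drop d (drop (i * d) p)) (drop (count_list (take (i * d) p) None + count_list (block d i p) None) x)"
    by (subst block_split[of p i d]) (simp add: fill_append add.commute)
  moreover have "block d i (a @ b @ c) = b" if "length a = i * d" "length b = d" for a b c :: "'b list"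
    using that by (simp add: block_def)
  ultimately show ?thesis
    using l by simp
qed

lemma count_block_le: "count_list (take (i * d) p) a + count_list (block d i p) a \<le> count_list p a"
proof -
  have "count_list p a = count_list (take (i * d) p) a + count_list (block d i p) a
      + count_list (drop d (drop (i * d) p)) a"
    using arg_cong[OF block_split[of p i d], of "\<lambda>q. count_list q a"] by simp
  then show ?thesis by simp
qed

lemma sum_count_block: "(\<Sum>i<n. count_list (block d i p) a) = count_list (take (n * d) p) a"
proof (induction n)
  case (Suc n)
  have "take (n * d + d) p = take (n * d) p @ block d n p"
    by (simp only: block_def take_add)
  then show ?case using Suc by (simp add: add.commute)
qed simp

lemma block_concat_replicate:
  assumes "length z = d" "i < n"
  shows "block d i (concat (replicate n z)) = z"
proof -
  have "replicate n z = replicate i z @ z # replicate (n - Suc i) z"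
    using assms(2) by (metis Suc_diff_Suc add_diff_inverse_nat less_imp_le not_le replicate_Suc replicate_add)
  then have "concat (replicate n z) = concat (replicate i z) @ z @ concat (replicate (n - Suc i) z)"
    by simp
  moreover have "length (concat (replicate i z)) = i * d"
    using assms(1) by (induction i) auto
  ultimately show ?thesis using assms(1) by (simp add: block_def)
qed

text \<open>Factor \<open>j\<close> contributes \<open>snd (\<alpha> ! j)\<close> holes, distributed
  over the \<open>n\<close> blocks, so there are \<open>d\<close> holes altogether. An argument
  whose blocks contain no hole does not depend on \<open>X\<close>, and its constant value can be
  read off at \<open>X0\<close>.\<close>

lemma preserves_filled:
  assumes \<rho>: "generalized_quasiorder A \<alpha> \<rho>" and dim: "dimension \<alpha> = d"
    and n: "1 \<le> n" and X0: "X0 \<in> arity_dom \<alpha>"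
    and f: "\<And>f'. f' \<in> trl A d (n, f) \<Longrightarrow> preserves d f' \<alpha> \<rho>"
    and gs: "gs \<in> tuples \<rho> n"
    and p: "\<And>j. j < length \<alpha> \<Longrightarrow> p j \<in> patterns (fst (\<alpha> ! j)) (n * snd (\<alpha> ! j))"
    and count: "\<And>j. j < length \<alpha> \<Longrightarrow> count_list (p j) None = snd (\<alpha> ! j)"
  shows "(\<lambda>X\<in>arity_dom \<alpha>. f (map (\<lambda>i. (gs ! i)
      (map (\<lambda>j. block (snd (\<alpha> ! j)) i (fill (p j) (X ! j))) [0..<length \<alpha>])) [0..<n])) \<in> \<rho>"
proof -
  let ?s = "length \<alpha>"
  define q where "q i j = block (snd (\<alpha> ! j)) i (p j)" for i j
  define u where "u i j = count_list (take (i * snd (\<alpha> ! j)) (p j)) None" for i j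
  define h where "h i = (\<lambda>X\<in>arity_dom \<alpha>. (gs ! i)
      (map (\<lambda>j. block (snd (\<alpha> ! j)) i (fill (p j) (X ! j))) [0..<?s]))" for i
  have block_h: "block (snd (\<alpha> ! j)) i (fill (p j) x) = fill (q i j) (drop (u i j) x)"
    if "i < n" "j < ?s" for i j x
    unfolding q_def u_def using that patterns_length[OF p] by (intro block_fill) auto
  have h: "h i \<in> \<rho>" if i: "i < n" for i
  proof -
    have "(\<lambda>X\<in>arity_dom \<alpha>. (gs ! i) (map (\<lambda>j. fill (q i j) (drop (u i j) (X ! j))) [0..<?s])) \<in> \<rho>"
    proof (rule gquord_fill[OF \<rho>])
      show "gs ! i \<in> \<rho>" using gs i by (rule tuples_nth)
      fix j assume j: "j < ?s"
      show "q i j \<in> patterns (fst (\<alpha> ! j)) (snd (\<alpha> ! j))"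
        using p[OF j] i unfolding q_def patterns_def by (rule block_in_tuples)
      show "u i j + count_list (q i j) None \<le> snd (\<alpha> ! j)"
        unfolding u_def q_def count[OF j, symmetric] by (metis count_block_le count[OF j])
    qed
    also have "(\<lambda>X\<in>arity_dom \<alpha>. (gs ! i) (map (\<lambda>j. fill (q i j) (drop (u i j) (X ! j))) [0..<?s])) = h i"
      unfolding h_def by (intro restrict_ext arg_cong[where f = "gs ! i"]) (simp add: block_h[OF i])
    finally show ?thesis .
  qed
  have hA: "h i X \<in> A" if "i < n" "X \<in> arity_dom \<alpha>" for i X
    using h[OF that(1)] that(2) generalized_quasiorderD(1)[OF \<rho>] by (blast dest: PiE_mem)
  \<comment> \<open>These arguments become the kept variables of the translation. Each of them takes
    at least one of the \<open>d\<close> holes, whence \<open>card K \<le> d\<close> by counting the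
    holes in two ways.\<close>
  define K where "K = {i. i < n \<and> (\<exists>j<?s. None \<in> set (q i j))}"
  have K: "K \<subseteq> {..<n}" "finite K" by (auto simp: K_def)
  have "card K = (\<Sum>i\<in>K. 1)" by simp
  also have "\<dots> \<le> (\<Sum>i\<in>K. \<Sum>j<?s. count_list (q i j) None)"
  proof (rule sum_mono)
    fix i assume "i \<in> K"
    then obtain j where j: "j < ?s" "None \<in> set (q i j)" by (auto simp: K_def)
    then have "1 \<le> count_list (q i j) None"
      by (metis One_nat_def Suc_leI count_list_0_iff gr0I)
    also have "\<dots> \<le> (\<Sum>j<?s. count_list (q i j) None)"
      using j by (intro member_le_sum) auto
    finally show "1 \<le> (\<Sum>j<?s. count_list (q i j) None)" .
  qed
  also have "\<dots> \<le> (\<Sum>i<n. \<Sum>j<?s. count_list (q i j) None)"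
    using K by (intro sum_mono2) auto
  also have "\<dots> = (\<Sum>j<?s. \<Sum>i<n. count_list (q i j) None)"
    by (rule sum.swap)
  also have "\<dots> = (\<Sum>j<?s. snd (\<alpha> ! j))"
    using count patterns_length[OF p] by (intro sum.cong) (auto simp: q_def sum_count_block)
  also have "\<dots> = d"
    unfolding dim[symmetric] dimension_def
    by (simp add: sum_list_sum_nth atLeast0LessThan)
  finally have card: "card K \<le> d" .
  have const: "h i X = h i X0" if i: "i < n" "i \<notin> K" and X: "X \<in> arity_dom \<alpha>" for i X
  proof -
    have "map (\<lambda>j. block (snd (\<alpha> ! j)) i (fill (p j) (X ! j))) [0..<?s]
      = map (\<lambda>j. block (snd (\<alpha> ! j)) i (fill (p j) (X0 ! j))) [0..<?s]"
      using i by (auto simp: block_h K_def intro: fill_cong_None)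
    then show ?thesis using X X0 by (simp only: h_def restrict_apply if_True)
  qed
  \<comment> \<open>This is the place that \<open>trl\<close> gives to the kept variable
    \<open>i\<close>, for \<open>u = 0\<close>.\<close>
  define r where "r i = card {k \<in> K. k < i}" for i
  have r_less: "r i < r i'" if "i \<in> K" "i < i'" for i i'
    unfolding r_def using that K(2) by (intro psubset_card_mono) auto
  have r_card: "r i < card K" if "i \<in> K" for i
    unfolding r_def using that K(2) by (intro psubset_card_mono) auto
  have inj: "inj_on r K"
    by (rule linorder_inj_onI) (auto dest: r_less)
  \<comment> \<open>Place \<open>r i\<close> must hold \<open>h i\<close>. The other places belong
    to fictitious variables of the translation and may hold any member of the relation;
    \<open>h 0\<close> is one because \<open>1 \<le> n\<close>.\<close>
  define hs where "hs = map (\<lambda>m. h (if m \<in> r ` K then inv_into K r m else 0)) [0..<d]"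
  have hs: "hs \<in> tuples \<rho> d"
  proof -
    have "h (if m \<in> r ` K then inv_into K r m else 0) \<in> \<rho>" for m
      using n K(1) inv_into_into[of m r K] by (auto intro!: h)
    then show ?thesis by (auto simp: hs_def tuples_def)
  qed
  define f' where "f' = (\<lambda>y\<in>tuples A d.
      f (map (\<lambda>i. if i \<in> K then y ! (0 + card {k \<in> K. k < i}) else map (\<lambda>i. h i X0) [0..<n] ! i) [0..<n]))"
  have "map (\<lambda>i. h i X0) [0..<n] \<in> tuples A n"
    using hA[OF _ X0] by (auto simp: tuples_def)
  then have "f' \<in> trl A d (n, f)"
    unfolding trl_def f'_def using K(1) card by (simp, intro exI conjI) auto
  then have "preserves d f' \<alpha> \<rho>" by (rule f)
  then have "(\<lambda>X\<in>arity_dom \<alpha>. f' (map (\<lambda>g. g X) hs)) \<in> \<rho>"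
    using hs by (auto simp: preserves_def)
  also have "(\<lambda>X\<in>arity_dom \<alpha>. f' (map (\<lambda>g. g X) hs)) = (\<lambda>X\<in>arity_dom \<alpha>. f (map (\<lambda>i. (gs ! i)
      (map (\<lambda>j. block (snd (\<alpha> ! j)) i (fill (p j) (X ! j))) [0..<?s])) [0..<n]))"
  proof (intro restrict_ext)
    fix X assume X: "X \<in> arity_dom \<alpha>"
    let ?y = "map (\<lambda>g. g X) hs"
    have "?y \<in> tuples A d"
      using hs X generalized_quasiorderD(1)[OF \<rho>] by (fastforce simp: tuples_def dest: PiE_mem)
    then have "f' ?y = f (map (\<lambda>i. if i \<in> K then ?y ! r i else map (\<lambda>i. h i X0) [0..<n] ! i) [0..<n])"
      unfolding f'_def r_def add_0 by simp
    also have "\<dots> = f (map (\<lambda>i. h i X) [0..<n])"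
    proof (intro arg_cong[where f = f] map_cong refl)
      fix i assume "i \<in> set [0..<n]"
      then have i: "i < n" by simp
      show "(if i \<in> K then ?y ! r i else map (\<lambda>i. h i X0) [0..<n] ! i) = h i X"
      proof (cases "i \<in> K")
        case True
        then have "r i < d" using r_card card by (meson less_le_trans)
        then have "?y ! r i = h i X"
          using True inj by (simp add: hs_def)
        then show ?thesis using True by simp
      next
        case False
        then show ?thesis using const[OF i False X] i by simp
      qed
    qed
    also have "map (\<lambda>i. h i X) [0..<n] = map (\<lambda>i. (gs ! i)
      (map (\<lambda>j. block (snd (\<alpha> ! j)) i (fill (p j) (X ! j))) [0..<?s])) [0..<n]"
      using X by (simp add: h_def)
    finally show "f' ?y = f (map (\<lambda>i. (gs ! i)
      (map (\<lambda>j. block (snd (\<alpha> ! j)) i (fill (p j) (X ! j))) [0..<?s])) [0..<n])" .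
  qed
  finally show ?thesis .
qed

text \<open>In the proof \<open>F 0 p\<close> is the fully filled composite and
  \<open>F (length \<alpha>) p\<close> the desired one; each step from \<open>m\<close> to
  \<open>Suc m\<close> merges the \<open>n\<close> copies of factor \<open>m\<close> by
  \<open>transitive_diagonal\<close>. That lemma asks for every pattern in factor \<open>m\<close>,
  so the induction must treat all \<open>p\<close> at once. The point \<open>X0\<close> supplies
  constants in every factor.\<close>

lemma preserves_of_trl:
  fixes \<alpha> :: "'b arity"
  assumes \<rho>: "generalized_quasiorder A \<alpha> \<rho>" and dim: "dimension \<alpha> = d"
    and f_op: "f \<in> ops A n" and n: "1 \<le> n" and X0: "X0 \<in> arity_dom \<alpha>"
    and f: "\<And>f'. f' \<in> trl A d (n, f) \<Longrightarrow> preserves d f' \<alpha> \<rho>"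
  shows "preserves n f \<alpha> \<rho>"
  unfolding preserves_def
proof
  fix gs assume gs: "gs \<in> tuples \<rho> n"
  let ?s = "length \<alpha>" and ?D = "\<lambda>j. snd (\<alpha> ! j)" and ?B = "\<lambda>j. fst (\<alpha> ! j)"
  note \<rho>E = generalized_quasiorderD(1)[OF \<rho>]
  define P where "P p \<longleftrightarrow> (\<forall>j<?s. p j \<in> patterns (?B j) (n * ?D j) \<and> count_list (p j) None = ?D j)" for p
  define arg where "arg m p i X =
      map (\<lambda>j. if j < m then X ! j else block (?D j) i (fill (p j) (X ! j))) [0..<?s]"
    for m i and p :: "nat \<Rightarrow> 'b option list" and X :: "'b list list"
  define F where "F m p = (\<lambda>X\<in>arity_dom \<alpha>. f (map (\<lambda>i. (gs ! i) (arg m p i X)) [0..<n]))" for m p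
  have fill_t: "fill (p j) x \<in> tuples (?B j) (n * ?D j)" if "P p" "j < ?s" "x \<in> tuples (?B j) (?D j)" for p j x
    using that unfolding P_def by (intro fill_in_tuples) (auto simp: tuples_def)
  have gsA: "(gs ! i) X \<in> A" if "i < n" "X \<in> arity_dom \<alpha>" for i X
    using tuples_nth[OF gs that(1)] that(2) \<rho>E by (blast dest: PiE_mem)
  have fA: "f (map (\<lambda>i. (gs ! i) (xs i)) [0..<n]) \<in> A" if "\<And>i. i < n \<Longrightarrow> xs i \<in> arity_dom \<alpha>" for xs
  proof -
    have "map (\<lambda>i. (gs ! i) (xs i)) [0..<n] \<in> tuples A n"
      using gsA that by (auto simp: tuples_def)
    then show ?thesis using f_op by (auto simp: ops_def)
  qed
  have arg_dom: "arg m p i X \<in> arity_dom \<alpha>" if "P p" "i < n" "X \<in> arity_dom \<alpha>" for m p i X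
    using that fill_t block_in_tuples by (fastforce simp: arg_def arity_dom_iff)
  have FE: "F m p \<in> arity_dom \<alpha> \<rightarrow>\<^sub>E A" if "P p" for m p
    using arg_dom[OF that] fA by (auto simp: F_def)
  \<comment> \<open>Factors below \<open>m\<close> have been identified, the others are still filled according to \<open>p\<close>.\<close>
  have F\<rho>: "F m p \<in> \<rho>" if "P p" "m \<le> ?s" for m p
    using that
  proof (induction m arbitrary: p)
    case 0
    have "(\<lambda>X\<in>arity_dom \<alpha>. f (map (\<lambda>i. (gs ! i)
      (map (\<lambda>j. block (snd (\<alpha> ! j)) i (fill (p j) (X ! j))) [0..<length \<alpha>])) [0..<n])) \<in> \<rho>"
      using 0(1) by (intro preserves_filled[OF \<rho> dim n X0 f gs]) (auto simp: P_def)
    then show ?case by (simp only: F_def arg_def not_less0 if_False)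
  next
    case (Suc m)
    then have m: "m < ?s" by simp
    let ?dom' = "arity_dom (delete_factor m \<alpha>)"
    \<comment> \<open>The inserted \<open>[]\<close> only keeps the positions aligned: whatever
      \<open>arg\<close> computes from it is overwritten by the block of \<open>Z\<close>.\<close>
    define ins where "ins Z Y i = (arg m p i (take m Y @ [] # drop m Y))[m := block (?D m) i Z]" for Z Y i
    have arg_upd: "arg m (p(m := q)) i (take m Y @ x # drop m Y) = ins (fill q x) Y i"
      if "Y \<in> ?dom'" for q i x Y
      using arity_dom_delete_length[OF m that] m
      by (intro nth_equalityI) (auto simp: arg_def ins_def nth_list_update nth_append nth_Cons')
    have ins_dom: "ins Z Y i \<in> arity_dom \<alpha>"
      if "Y \<in> ?dom'" "Z \<in> tuples (?B m) (n * ?D m)" "i < n" for Z Y i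
    proof -
      have *: "take m Y @ (X0 ! m) # drop m Y \<in> arity_dom \<alpha>"
        using X0 m by (intro arity_dom_insert that) (auto simp: arity_dom_iff)
      have "ins Z Y i = (arg m p i (take m Y @ (X0 ! m) # drop m Y))[m := block (?D m) i Z]"
        using arity_dom_delete_length[OF m that(1)] m
        by (intro nth_equalityI) (auto simp: arg_def ins_def nth_list_update nth_append nth_Cons')
      with arg_dom[OF Suc.prems(1) that(3) *, of m] block_in_tuples[OF that(2,3)]
      show ?thesis by (simp add: arity_dom_update)
    qed
    define k where "k Z = (\<lambda>Y\<in>?dom'. f (map (\<lambda>i. (gs ! i) (ins Z Y i)) [0..<n]))" for Z
    \<comment> \<open>Together with the variables themselves, these \<open>n - 1\<close> further
      copies make up the \<open>n\<close> blocks.\<close>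
    define I :: "(nat + 'b) list" where "I = concat (replicate (n - 1) (map Inl [0..<?D m]))"
    have "length I = (n - 1) * ?D m"
      unfolding I_def by (induction "n - 1") (auto simp: length_concat sum_list_replicate)
    then have len: "?D m + length I = n * ?D m"
      using n by (simp add: diff_mult_distrib)
    have "(\<lambda>x\<in>tuples (?B m) (?D m). k (x @ map (case_sum ((!) x) id) I)) \<in> curry_at \<alpha> m ` \<rho>"
    proof (rule transitive_diagonal[OF generalized_quasiorderD(3)[OF \<rho> m]], unfold len)
      show "k \<in> tuples (?B m) (n * ?D m) \<rightarrow> curry_base A \<alpha> m"
        using fA ins_dom by (auto simp: k_def curry_base_def)
      show "set I \<subseteq> Inl ` {..<?D m} \<union> Inr ` ?B m" by (auto simp: I_def)
      fix q assume q: "q \<in> patterns (?B m) (n * ?D m)" "count_list q None = ?D m"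
      have "F m (p(m := q)) \<in> \<rho>"
        using q Suc.prems by (intro Suc.IH) (auto simp: P_def)
      moreover have "curry_at \<alpha> m (F m (p(m := q))) = (\<lambda>x\<in>tuples (?B m) (?D m). k (fill q x))"
        unfolding curry_at_def k_def using arity_dom_insert[OF m] arg_upd
        by (intro restrict_ext) (simp add: F_def)
      ultimately show "(\<lambda>x\<in>tuples (?B m) (?D m). k (fill q x)) \<in> curry_at \<alpha> m ` \<rho>"
        by (metis imageI)
    qed
    also have "(\<lambda>x\<in>tuples (?B m) (?D m). k (x @ map (case_sum ((!) x) id) I)) = curry_at \<alpha> m (F (Suc m) p)"
      unfolding curry_at_def k_def
    proof (intro restrict_ext)
      fix x Y assume x: "x \<in> tuples (?B m) (?D m)" and Y: "Y \<in> ?dom'"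
      have "map (case_sum ((!) x) id) (map Inl [0..<?D m] :: (nat + 'b) list) = x"
        using tuples_length[OF x] map_nth[of x] by (simp add: comp_def)
      then have "x @ map (case_sum ((!) x) id) I = x @ concat (replicate (n - 1) x)"
        unfolding I_def by (simp only: map_concat map_replicate)
      also have "\<dots> = concat (replicate n x)"
        using n by (cases n) auto
      finally have z: "x @ map (case_sum ((!) x) id) I = concat (replicate n x)" .
      have "ins (concat (replicate n x)) Y i = arg (Suc m) p i (take m Y @ x # drop m Y)" if "i < n" for i
        using arity_dom_delete_length[OF m Y] m block_concat_replicate[OF tuples_length[OF x] that]
        by (intro nth_equalityI) (auto simp: arg_def ins_def nth_list_update nth_append nth_Cons')
      then have "map (\<lambda>i. (gs ! i) (ins (concat (replicate n x)) Y i)) [0..<n]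
          = map (\<lambda>i. (gs ! i) (arg (Suc m) p i (take m Y @ x # drop m Y))) [0..<n]"
        by simp
      then show "f (map (\<lambda>i. (gs ! i) (ins (x @ map (case_sum ((!) x) id) I) Y i)) [0..<n])
         = F (Suc m) p (take m Y @ x # drop m Y)"
        unfolding z using arity_dom_insert[OF m Y x] by (simp only: F_def restrict_apply if_True)
    qed
    finally show ?case
      by (rule curry_at_imageD[OF _ m \<rho>E FE[OF Suc.prems(1)]])
  qed
  \<comment> \<open>The final composite does not depend on \<open>p\<close>, but some family of
    patterns is needed to reach it: holes in the first copy, entries of \<open>X0\<close> in all
    others.\<close>
  have "\<exists>p. P p"
  proof -
    have "\<exists>q. q \<in> patterns (?B j) (n * ?D j) \<and> count_list q None = ?D j" if j: "j < ?s" for j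
    proof -
      let ?c = "map Some (concat (replicate (n - 1) (X0 ! j)))"
      have X: "set (X0 ! j) \<subseteq> ?B j" "length (X0 ! j) = ?D j"
        using X0 j by (auto simp: arity_dom_iff tuples_def)
      have "length ?c = (n - 1) * ?D j"
        using X(2) by (induction "n - 1") (auto simp: length_concat sum_list_replicate)
      moreover have "count_list (replicate (?D j) None) None = ?D j"
        by (metis count_list_eq_length length_replicate)
      moreover have "count_list ?c None = 0" by (auto simp: count_list_0_iff)
      ultimately have "replicate (?D j) None @ ?c \<in> patterns (?B j) (n * ?D j)"
          "count_list (replicate (?D j) None @ ?c) None = ?D j"
        using X n by (auto simp: patterns_def tuples_def diff_mult_distrib)
      then show ?thesis by blast
    qed
    then show ?thesis unfolding P_def by metis
  qed
  then obtain p where "P p" ..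
  then have "F ?s p \<in> \<rho>" by (intro F\<rho>) auto
  also have "F ?s p = (\<lambda>X\<in>arity_dom \<alpha>. f (map (\<lambda>g. g X) gs))"
    unfolding F_def
  proof (intro restrict_ext arg_cong[where f = f])
    fix X assume "X \<in> arity_dom \<alpha>"
    then have "arg ?s p i X = X" for i
      by (intro nth_equalityI) (auto simp: arg_def arity_dom_iff)
    then show "map (\<lambda>i. (gs ! i) (arg ?s p i X)) [0..<n] = map (\<lambda>g. g X) gs"
      using tuples_length[OF gs] by (intro nth_equalityI) auto
  qed
  finally show "(\<lambda>X\<in>arity_dom \<alpha>. f (map (\<lambda>g. g X) gs)) \<in> \<rho>" .
qed

section \<open>Clones of polymorphisms, and closure properties of clone fragments\<close>

text \<open>A set of the form \<open>star A d N\<close> has members of many arities, so it has to be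
  compared with polymorphisms of all arities rather than with the \<open>d\<close>-ary ones in
  \<open>Pol\<close>.\<close>

definition Pol_ops :: "'a set \<Rightarrow> ('b arity \<times> ('b list list \<Rightarrow> 'a) set) set \<Rightarrow> 'a operation set" where
  "Pol_ops A T = {(n, f) \<in> Op A. \<forall>(\<alpha>, \<rho>)\<in>T. preserves n f \<alpha> \<rho>}"

lemma projection_in_ops: "i < n \<Longrightarrow> projection A n i \<in> ops A n"
  by (auto simp: projection_def ops_def tuples_nth)

lemma compose_op_in_ops:
  "f \<in> ops A n \<Longrightarrow> gs \<in> tuples (ops A k) n \<Longrightarrow> compose_op A k f gs \<in> ops A k"
  by (fastforce simp: compose_op_def ops_def tuples_def)

lemma preserves_projection:
  assumes "i < n" "\<rho> \<subseteq> arity_dom \<alpha> \<rightarrow>\<^sub>E A"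
  shows "preserves n (projection A n i) \<alpha> \<rho>"
  unfolding preserves_def
proof
  fix gs assume gs: "gs \<in> tuples \<rho> n"
  have i: "gs ! i \<in> \<rho>" using gs assms(1) by (rule tuples_nth)
  have "(\<lambda>X\<in>arity_dom \<alpha>. projection A n i (map (\<lambda>g. g X) gs)) = restrict (gs ! i) (arity_dom \<alpha>)"
  proof (intro restrict_ext)
    fix X assume "X \<in> arity_dom \<alpha>"
    then have "map (\<lambda>g. g X) gs \<in> tuples A n"
      using gs assms(2) by (auto simp: tuples_def dest: subsetD PiE_mem)
    then show "projection A n i (map (\<lambda>g. g X) gs) = (gs ! i) X"
      using assms(1) tuples_length[OF gs] by (simp add: projection_def)
  qed
  also have "\<dots> = gs ! i" using i assms(2) by (metis PiE_restrict subsetD)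
  finally show "(\<lambda>X\<in>arity_dom \<alpha>. projection A n i (map (\<lambda>g. g X) gs)) \<in> \<rho>" using i by simp
qed

lemma preserves_compose_op:
  assumes \<rho>: "\<rho> \<subseteq> arity_dom \<alpha> \<rightarrow>\<^sub>E A" and f: "preserves n f \<alpha> \<rho>"
    and hs: "length hs = n" "\<And>h. h \<in> set hs \<Longrightarrow> preserves k h \<alpha> \<rho>"
  shows "preserves k (compose_op A k f hs) \<alpha> \<rho>"
  unfolding preserves_def
proof
  fix gs assume gs: "gs \<in> tuples \<rho> k"
  let ?hs = "map (\<lambda>h. \<lambda>X\<in>arity_dom \<alpha>. h (map (\<lambda>g. g X) gs)) hs"
  have "?hs \<in> tuples \<rho> n"
    using hs gs by (auto simp: tuples_def preserves_def)
  then have "(\<lambda>X\<in>arity_dom \<alpha>. f (map (\<lambda>g. g X) ?hs)) \<in> \<rho>"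
    using f unfolding preserves_def by blast
  also have "(\<lambda>X\<in>arity_dom \<alpha>. f (map (\<lambda>g. g X) ?hs))
     = (\<lambda>X\<in>arity_dom \<alpha>. compose_op A k f hs (map (\<lambda>g. g X) gs))"
  proof (intro restrict_ext)
    fix X assume X: "X \<in> arity_dom \<alpha>"
    then have "map (\<lambda>g. g X) gs \<in> tuples A k"
      using gs \<rho> by (auto simp: tuples_def dest: subsetD PiE_mem)
    then show "f (map (\<lambda>g. g X) ?hs) = compose_op A k f hs (map (\<lambda>g. g X) gs)"
      using X by (simp add: compose_op_def comp_def)
  qed
  finally show "(\<lambda>X\<in>arity_dom \<alpha>. compose_op A k f hs (map (\<lambda>g. g X) gs)) \<in> \<rho>" .
qed

lemma is_clone_Pol_ops:
  assumes T: "\<And>\<alpha> \<rho>. (\<alpha>, \<rho>) \<in> T \<Longrightarrow> \<rho> \<subseteq> arity_dom \<alpha> \<rightarrow>\<^sub>E A"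
  shows "is_clone A (Pol_ops A T)"
  unfolding is_clone_def
proof (intro conjI allI impI)
  show "Pol_ops A T \<subseteq> Op A" by (auto simp: Pol_ops_def)
  show "(n, projection A n i) \<in> Pol_ops A T" if "i < n" for n i
    using that preserves_projection[OF that T]
    by (auto simp: Pol_ops_def Op_def intro: projection_in_ops)
  show "(k, compose_op A k f gs) \<in> Pol_ops A T"
    if "(n, f) \<in> Pol_ops A T" "1 \<le> k" "gs \<in> tuples (level (Pol_ops A T) k) n" for n f k gs
  proof -
    have "gs \<in> tuples (ops A k) n" "length gs = n"
      "\<And>g \<alpha> \<rho>. g \<in> set gs \<Longrightarrow> (\<alpha>, \<rho>) \<in> T \<Longrightarrow> preserves k g \<alpha> \<rho>"
      using that(3) by (auto simp: tuples_def level_def Pol_ops_def Op_def)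
    moreover have "preserves k (compose_op A k f gs) \<alpha> \<rho>" if "(\<alpha>, \<rho>) \<in> T" for \<alpha> \<rho>
      using calculation that \<open>(n, f) \<in> Pol_ops A T\<close>
      by (intro preserves_compose_op[OF T]) (auto simp: Pol_ops_def)
    ultimately show ?thesis
      using that(1,2) by (auto simp: Pol_ops_def Op_def intro: compose_op_in_ops)
  qed
qed

lemma level_Pol_ops: "1 \<le> d \<Longrightarrow> level (Pol_ops A T) d = Pol d A T"
  by (auto simp: level_def Pol_ops_def Pol_def Op_def)

text \<open>The \<open>d\<close>-ary members of \<open>C\<close> generate a clone inside
  \<open>C\<close>, so no new \<open>d\<close>-ary operation can appear.\<close>

lemma clone_fragment_level:
  assumes C: "is_clone A C"
  shows "clone_fragment A d (level C d)"
proof -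
  have "clone_generated A ({d} \<times> level C d) \<subseteq> C"
    unfolding clone_generated_def using C by (intro hull_minimal) (auto simp: level_def)
  moreover have "{d} \<times> level C d \<subseteq> clone_generated A ({d} \<times> level C d)"
    unfolding clone_generated_def by (rule hull_subset)
  moreover have "level C d \<subseteq> ops A d"
    using C by (auto simp: is_clone_def level_def Op_def)
  ultimately show ?thesis
    by (auto simp: clone_fragment_def level_def)
qed

lemma clone_fragment_compose_op:
  assumes "clone_fragment A d N" "1 \<le> d" "f \<in> N" "gs \<in> tuples N d"
  shows "compose_op A d f gs \<in> N"
proof -
  have "(d, compose_op A d f gs) \<in> C" if "is_clone A C" "{d} \<times> N \<subseteq> C" for C
  proof -
    have "gs \<in> tuples (level C d) d" "(d, f) \<in> C"
      using assms that by (auto simp: tuples_def level_def)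
    then show ?thesis using that(1) assms(2) by (auto simp: is_clone_def)
  qed
  then have "compose_op A d f gs \<in> level (clone_generated A ({d} \<times> N)) d"
    by (auto simp: level_def clone_generated_def hull_def)
  then show ?thesis using assms(1) by (auto simp: clone_fragment_def)
qed

lemma clone_fragment_projection:
  assumes "clone_fragment A d N" "i < d"
  shows "projection A d i \<in> N"
proof -
  have "(d, projection A d i) \<in> C" if "is_clone A C" for C
    using that assms(2) by (auto simp: is_clone_def)
  then have "projection A d i \<in> level (clone_generated A ({d} \<times> N)) d"
    by (auto simp: level_def clone_generated_def hull_def)
  then show ?thesis using assms(1) by (auto simp: clone_fragment_def)
qed

section \<open>Substitution of variables and constants, and its relation to translations\<close>

text \<open>Each entry of \<open>J\<close> prescribes one argument: \<open>Inl i\<close> the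
  variable \<open>i\<close>, \<open>Inr c\<close> the constant \<open>c\<close>. Through
  \<open>subst_ops\<close> such a substitution becomes a composition with projections and constant
  operations.\<close>

definition subst_args :: "'b list \<Rightarrow> (nat + 'b) list \<Rightarrow> 'b list" where
  "subst_args x J = map (case_sum ((!) x) id) J"

definition subst_ops :: "'a set \<Rightarrow> nat \<Rightarrow> (nat + 'a) list \<Rightarrow> ('a list \<Rightarrow> 'a) list" where
  "subst_ops A d J = map (case_sum (projection A d) (\<lambda>c. \<lambda>x\<in>tuples A d. c)) J"

lemma compose_op_subst_ops:
  "compose_op A d f (subst_ops A d J) = (\<lambda>x\<in>tuples A d. f (subst_args x J))"
  unfolding compose_op_def subst_ops_def subst_args_def
  by (intro restrict_ext arg_cong[where f = f])
     (auto simp: projection_def comp_def split: sum.splits)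

lemma subst_ops_in_tuples:
  assumes "const_ops A d \<subseteq> N" "\<And>i. i < d \<Longrightarrow> projection A d i \<in> N"
    "set J \<subseteq> Inl ` {..<d} \<union> Inr ` A"
  shows "subst_ops A d J \<in> tuples N (length J)"
proof -
  have "case_sum (projection A d) (\<lambda>c. \<lambda>x\<in>tuples A d. c) a \<in> N" if "a \<in> set J" for a
  proof -
    from that assms(3) have "a \<in> Inl ` {..<d} \<union> Inr ` A" by blast
    then show ?thesis using assms(1,2) by (auto simp: const_ops_def)
  qed
  then show ?thesis by (auto simp: subst_ops_def tuples_def[of N])
qed

lemma clone_fragment_subst:
  assumes "clone_fragment A d N" "const_ops A d \<subseteq> N" "1 \<le> d" "f \<in> N"
    "length J = d" "set J \<subseteq> Inl ` {..<d} \<union> Inr ` A"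
  shows "(\<lambda>x\<in>tuples A d. f (subst_args x J)) \<in> N"
  using clone_fragment_compose_op[OF assms(1,3,4), of "subst_ops A d J"]
    subst_ops_in_tuples[OF assms(2) clone_fragment_projection[OF assms(1)] assms(6)] assms(5)
  by (simp add: compose_op_subst_ops)

lemma clone_subst:
  assumes "is_clone A C" "const_ops A d \<subseteq> level C d" "1 \<le> d" "(n, f) \<in> C"
    "length J = n" "set J \<subseteq> Inl ` {..<d} \<union> Inr ` A"
  shows "(d, \<lambda>x\<in>tuples A d. f (subst_args x J)) \<in> C"
proof -
  have "subst_ops A d J \<in> tuples (level C d) n"
    using assms subst_ops_in_tuples[of A d "level C d" J] by (auto simp: is_clone_def level_def)
  then have "(d, compose_op A d f (subst_ops A d J)) \<in> C"
    using assms by (auto simp: is_clone_def)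
  then show ?thesis by (simp add: compose_op_subst_ops)
qed

lemma rank_less_card: "finite K \<Longrightarrow> i \<in> K \<Longrightarrow> card {k \<in> K. k < (i::nat)} < card K"
  by (intro psubset_card_mono) auto

text \<open>A translation puts only variables and constants in for the arguments, so it is an
  instance of \<open>clone_subst\<close>. For polymorphisms this gives the easy half of the
  description of \<open>star\<close>.\<close>

lemma trl_subset_level:
  assumes C: "is_clone A C" "const_ops A d \<subseteq> level C d" and d: "1 \<le> d" and f: "(n, f) \<in> C"
  shows "trl A d (n, f) \<subseteq> level C d"
proof
  fix e assume "e \<in> trl A d (n, f)"
  then obtain K c u where K: "K \<subseteq> {..<n}" and c: "c \<in> tuples A n" and u: "u + card K \<le> d"
    and e: "e = (\<lambda>x\<in>tuples A d.
         f (map (\<lambda>i. if i \<in> K then x ! (u + card {k \<in> K. k < i}) else c ! i) [0..<n]))"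
    by (auto simp: trl_def)
  have fin: "finite K" using K finite_subset by blast
  define J where "J = map (\<lambda>i. if i \<in> K then Inl (u + card {k \<in> K. k < i}) else Inr (c ! i)) [0..<n]"
  have "set J \<subseteq> Inl ` {..<d} \<union> Inr ` A"
    using rank_less_card[OF fin] u tuples_nth[OF c] by (fastforce simp: J_def)
  then have "(d, \<lambda>x\<in>tuples A d. f (subst_args x J)) \<in> C"
    by (intro clone_subst[OF C d f]) (auto simp: J_def)
  moreover have "subst_args x J = map (\<lambda>i. if i \<in> K then x ! (u + card {k \<in> K. k < i}) else c ! i) [0..<n]" for x
    by (simp add: subst_args_def J_def)
  ultimately show "e \<in> level C d" by (simp add: e level_def)
qed

text \<open>Keeping all \<open>d\<close> variables makes \<open>f\<close> one of its own
  translations. Even then \<open>trl\<close> asks for a tuple of constants, which exists since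
  \<open>A \<noteq> {}\<close>.\<close>

lemma star_level_subset:
  assumes "(d, f) \<in> star A d N" "A \<noteq> {}"
  shows "f \<in> N"
proof -
  obtain a where a: "a \<in> A" using assms(2) by blast
  have "(\<lambda>x\<in>tuples A d. f (map (\<lambda>i. if i \<in> {..<d} then x ! (0 + card {k \<in> {..<d}. k < i})
          else replicate d a ! i) [0..<d])) \<in> trl A d (d, f)"
    using a unfolding trl_def
    by (simp, intro exI[of _ "{..<d}"] exI[of _ "replicate d a"] exI[of _ 0]) (auto simp: tuples_def)
  also have "(\<lambda>x\<in>tuples A d. f (map (\<lambda>i. if i \<in> {..<d} then x ! (0 + card {k \<in> {..<d}. k < i})
          else replicate d a ! i) [0..<d])) = restrict f (tuples A d)"
  proof (intro restrict_ext arg_cong[where f = f])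
    fix x assume x: "x \<in> tuples A d"
    have "{k \<in> {..<d}. k < i} = {..<i}" if "i < d" for i
      using that by auto
    then show "map (\<lambda>i. if i \<in> {..<d} then x ! (0 + card {k \<in> {..<d}. k < i})
          else replicate d a ! i) [0..<d] = x"
      using tuples_length[OF x] by (intro nth_equalityI) auto
  qed
  also have "\<dots> = f" using assms(1) by (auto simp: star_def Op_def ops_def PiE_restrict)
  finally show ?thesis using assms(1) by (auto simp: star_def)
qed

text \<open>A translation keeps at most \<open>d\<close> of the \<open>d + 1\<close> variables of
  \<open>h\<close>, so it fixes some variable \<open>i\<close>. Fixing this one first leads into
  \<open>N\<close>, and the rest of the translation is a substitution inside the fragment.\<close>

lemma in_star_Suc:
  assumes N: "clone_fragment A d N" "const_ops A d \<subseteq> N" and d: "1 \<le> d"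
    and h: "h \<in> ops A (Suc d)"
    and fix_arg: "\<And>i c. i \<le> d \<Longrightarrow> c \<in> A \<Longrightarrow> (\<lambda>x\<in>tuples A d. h (take i x @ c # drop i x)) \<in> N"
  shows "(Suc d, h) \<in> star A d N"
proof -
  have "e \<in> N" if e: "e \<in> trl A d (Suc d, h)" for e
  proof -
    obtain K c u where K: "K \<subseteq> {..<Suc d}" and c: "c \<in> tuples A (Suc d)" and u: "u + card K \<le> d"
      and e: "e = (\<lambda>x\<in>tuples A d.
           h (map (\<lambda>i. if i \<in> K then x ! (u + card {k \<in> K. k < i}) else c ! i) [0..<Suc d]))"
      using e unfolding trl_def by auto
    have fin: "finite K" using K finite_subset by blast
    have "K \<noteq> {..<Suc d}" using u by auto
    then obtain i where "i < Suc d" and i': "i \<notin> K" using K by blast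
    with less_Suc_eq_le have i: "i \<le> d" "i \<notin> K" by auto
    define \<phi> where "\<phi> k = (if k \<in> K then Inl (u + card {l \<in> K. l < k}) else Inr (c ! k))" for k
    \<comment> \<open>The prescriptions for the \<open>d\<close> arguments other than
      \<open>i\<close>.\<close>
    define J where "J = map \<phi> ([0..<i] @ [Suc i..<Suc d])"
    have "\<phi> k \<in> Inl ` {..<d} \<union> Inr ` A" if "k < Suc d" for k
      using rank_less_card[OF fin, of k] u tuples_nth[OF c that] by (auto simp: \<phi>_def)
    then have "\<phi> ` {..<Suc d} \<subseteq> Inl ` {..<d} \<union> Inr ` A" by blast
    moreover have "set J \<subseteq> \<phi> ` {..<Suc d}" using i by (auto simp: J_def)
    ultimately have "set J \<subseteq> Inl ` {..<d} \<union> Inr ` A" by (rule subset_trans[rotated])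
    moreover have "length J = d" using i by (simp add: J_def)
    ultimately have J: "set J \<subseteq> Inl ` {..<d} \<union> Inr ` A" "length J = d" .
    have "(\<lambda>x\<in>tuples A d. (\<lambda>x\<in>tuples A d. h (take i x @ c ! i # drop i x)) (subst_args x J)) \<in> N"
      using i J tuples_nth[OF c, of i] by (intro clone_fragment_subst[OF N d] fix_arg) auto
    also have "(\<lambda>x\<in>tuples A d. (\<lambda>x\<in>tuples A d. h (take i x @ c ! i # drop i x)) (subst_args x J)) = e"
      unfolding e
    proof (rule restrict_ext)
      fix x assume x: "x \<in> tuples A d"
      let ?\<psi> = "\<lambda>k. if k \<in> K then x ! (u + card {l \<in> K. l < k}) else c ! k"
      have s: "subst_args x J = map ?\<psi> [0..<i] @ map ?\<psi> [Suc i..<Suc d]"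
        by (simp add: subst_args_def J_def \<phi>_def del: upt_Suc)
      have "case_sum ((!) x) id a \<in> A" if "a \<in> set J" for a
      proof -
        from that J(1) have "a \<in> Inl ` {..<d} \<union> Inr ` A" by blast
        then show ?thesis using tuples_nth[OF x] by auto
      qed
      then have "subst_args x J \<in> tuples A d" using J(2) by (auto simp: subst_args_def tuples_def)
      moreover have "[0..<Suc d] = [0..<i] @ i # [Suc i..<Suc d]"
        using i upt_add_eq_append[of 0 i "Suc d - i"] upt_conv_Cons[of i "Suc d"] by simp
      then have "map ?\<psi> [0..<Suc d] = map ?\<psi> [0..<i] @ c ! i # map ?\<psi> [Suc i..<Suc d]"
        using i(2) by (simp del: upt_Suc)
      ultimately show "(\<lambda>x\<in>tuples A d. h (take i x @ c ! i # drop i x)) (subst_args x J)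
          = h (map ?\<psi> [0..<Suc d])"
        by (simp add: s del: upt_Suc)
    qed
    finally show ?thesis .
  qed
  then show ?thesis using h by (auto simp: star_def Op_def)
qed

text \<open>Here it matters that the star is a clone: it contains \<open>h\<close> by
  \<open>in_star_Suc\<close>, and identifying two variables of \<open>h\<close> is composition with
  projections. This is the source of transitivity of the relation \<open>N\<close>.\<close>

lemma Delta_subset_fragment:
  assumes N: "clone_fragment A d N" "const_ops A d \<subseteq> N" and clone: "is_clone A (star A d N)"
    and A: "A \<noteq> {}" and d: "1 \<le> d" and h: "h \<in> ops A (Suc d)"
    and fix_arg: "\<And>i c. i \<le> d \<Longrightarrow> c \<in> A \<Longrightarrow> (\<lambda>x\<in>tuples A d. h (take i x @ c # drop i x)) \<in> N"
    and i: "i < d" and j: "j \<le> d"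
  shows "(\<lambda>x\<in>tuples A d. h (take j x @ x ! i # drop j x)) \<in> N"
proof -
  let ?gs = "take j (map (projection A d) [0..<d]) @ projection A d i # drop j (map (projection A d) [0..<d])"
  have "(Suc d, h) \<in> star A d N" using N d h fix_arg by (rule in_star_Suc)
  moreover have "?gs \<in> tuples (level (star A d N) d) (Suc d)"
    using clone i by (intro tuples_insert) (auto simp: is_clone_def level_def tuples_def)
  ultimately have "(d, compose_op A d h ?gs) \<in> star A d N"
    using clone d by (auto simp: is_clone_def)
  then have "compose_op A d h ?gs \<in> N" using A by (rule star_level_subset)
  also have "compose_op A d h ?gs = (\<lambda>x\<in>tuples A d. h (take j x @ x ! i # drop j x))"
    unfolding compose_op_def
  proof (intro restrict_ext arg_cong[where f = h])
    fix x assume x: "x \<in> tuples A d"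
    then have "map (\<lambda>g. g x) (map (projection A d) [0..<d]) = x"
      using map_nth[of x] by (simp add: comp_def projection_def tuples_length)
    then show "map (\<lambda>g. g x) ?gs = take j x @ x ! i # drop j x"
      using x by (simp only: map_append list.map take_map[symmetric] drop_map[symmetric]) (simp add: projection_def)
  qed
  finally show ?thesis .
qed

section \<open>The generalized quasiorder formed by a clone fragment\<close>

lemma arity_dom_singleton: "arity_dom [(B, d)] = (\<lambda>x. [x]) ` tuples B d"
  by (auto simp: arity_dom_def set_Cons_def)

text \<open>
  A clone fragment \<open>N\<close> with clone \<open>N\<^sup>*\<close> is itself a generalized quasiorder, of arity \<open>A\<^sup>d\<close>; the
  bijection \<open>\<beta>\<close> transports it to a canonical arity.
\<close>

context
  fixes A :: "'a set" and B :: "'b set" and \<beta> :: "'b \<Rightarrow> 'a" and d :: nat and N :: "('a list \<Rightarrow> 'a) set"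
  assumes \<beta>: "bij_betw \<beta> B A" and A: "A \<noteq> {}" and d: "1 \<le> d"
    and N: "clone_fragment A d N" "const_ops A d \<subseteq> N" and clone: "is_clone A (star A d N)"
begin

definition transport :: "('a list \<Rightarrow> 'a) \<Rightarrow> 'b list list \<Rightarrow> 'a" where
  "transport g = (\<lambda>X\<in>arity_dom [(B, d)]. g (map \<beta> (hd X)))"

lemma map_beta: "x \<in> tuples B n \<Longrightarrow> map \<beta> x \<in> tuples A n"
  using \<beta> by (auto simp: tuples_def bij_betw_def)

lemma map_inv_beta: "y \<in> tuples A n \<Longrightarrow> map (inv_into B \<beta>) y \<in> tuples B n"
  using bij_betw_inv_into[OF \<beta>] by (auto simp: tuples_def bij_betw_def)

lemma map_beta_inv: "y \<in> tuples A n \<Longrightarrow> map \<beta> (map (inv_into B \<beta>) y) = y"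
  using \<beta> by (auto simp: tuples_def bij_betw_inv_into_right intro!: map_idI)

lemma map_inv_beta_beta: "x \<in> tuples B n \<Longrightarrow> map (inv_into B \<beta>) (map \<beta> x) = x"
  using \<beta> by (auto simp: tuples_def bij_betw_inv_into_left intro!: map_idI)

lemma N_ops: "N \<subseteq> ops A d"
  using N(1) by (simp add: clone_fragment_def)

lemma curry_transport:
  "curry_at [(B, d)] 0 (transport g) = (\<lambda>x\<in>tuples B d. \<lambda>Y\<in>{[]}. g (map \<beta> x))"
  unfolding curry_at_def
  by (simp add: delete_factor_def, intro restrict_ext)
     (auto simp: arity_dom_def transport_def set_Cons_def restrict_def)

lemma curry_base_transport: "curry_base A [(B, d)] 0 = {[]} \<rightarrow>\<^sub>E A"
  by (simp add: curry_base_def delete_factor_def arity_dom_def)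

text \<open>The transported relation after currying at its only factor. Deleting that factor leaves
  the empty arity, whose domain is \<open>{[]}\<close>, so the values are functions on
  \<open>{[]}\<close> instead of elements of \<open>A\<close>.\<close>

definition curried :: "('b list \<Rightarrow> 'b list list \<Rightarrow> 'a) set" where
  "curried = (\<lambda>g. \<lambda>x\<in>tuples B d. \<lambda>Y\<in>{[]}. g (map \<beta> x)) ` N"

lemma curriedI:
  assumes "(\<lambda>y\<in>tuples A d. g y) \<in> N" "\<And>x. x \<in> tuples B d \<Longrightarrow> e x = (\<lambda>Y\<in>{[]}. g (map \<beta> x))"
  shows "(\<lambda>x\<in>tuples B d. e x) \<in> curried"
  unfolding curried_def
proof (rule image_eqI[OF _ assms(1)])
  show "(\<lambda>x\<in>tuples B d. e x)
      = (\<lambda>x\<in>tuples B d. \<lambda>Y\<in>{[]}. (\<lambda>y\<in>tuples A d. g y) (map \<beta> x))"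
    using map_beta by (intro restrict_ext) (simp add: assms(2))
qed

lemma curried_reflexive: "simple_int_reflexive ({[]} \<rightarrow>\<^sub>E A) B d curried"
proof -
  \<comment> \<open>The functions \<open>r\<close>, \<open>r'\<close> and \<open>r''\<close> stand
    for one list operation, \<open>tl\<close> or \<open>butlast\<close>, at three types: lists over
    \<open>B\<close>, lists over \<open>A\<close> and substitution lists. Inserting a constant and
    then applying this operation is a substitution into \<open>g\<close>.\<close>
  have "(\<lambda>x\<in>tuples B (Suc d). (\<lambda>x\<in>tuples B d. \<lambda>Y\<in>{[]}. g (map \<beta> x)) (r x))
      \<in> circledast ({[]} \<rightarrow>\<^sub>E A) B d curried"
    if g: "g \<in> N"
      and r: "\<And>x. x \<in> tuples B (Suc d) \<Longrightarrow> r x \<in> tuples B d"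
      and r': "\<And>x. map \<beta> (r x) = r' (map \<beta> x)"
      and r'': "\<And>x J. map (case_sum ((!) x) id) (r'' J) = r' (map (case_sum ((!) x) id) J)"
      and r''_set: "\<And>J. set (r'' J) \<subseteq> set J" "\<And>J. length (r'' J) = length J - 1"
    for g and r :: "'b list \<Rightarrow> 'b list" and r' :: "'a list \<Rightarrow> 'a list"
      and r'' :: "(nat + 'a) list \<Rightarrow> (nat + 'a) list"
  proof -
    let ?e = "\<lambda>x\<in>tuples B (Suc d). (\<lambda>x\<in>tuples B d. \<lambda>Y\<in>{[]}. g (map \<beta> x)) (r x)"
    have "g y \<in> A" if "y \<in> tuples A d" for y
      using g N_ops that by (auto simp: ops_def)
    then have "?e \<in> tuples B (Suc d) \<rightarrow>\<^sub>E ({[]} \<rightarrow>\<^sub>E A)"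
      using r map_beta by (simp add: restrict_PiE_iff)
    moreover have "(\<lambda>x\<in>tuples B d. ?e (take i x @ c # drop i x)) \<in> curried"
      if i: "i \<le> d" and c: "c \<in> B" for i c
    proof (rule curriedI)
      let ?V = "map Inl [0..<d] :: (nat + 'a) list"
      let ?J = "r'' (take i ?V @ Inr (\<beta> c) # drop i ?V)"
      have "\<beta> c \<in> A" using c \<beta> by (auto simp: bij_betw_def)
      then have "set (take i ?V @ Inr (\<beta> c) # drop i ?V) \<subseteq> Inl ` {..<d} \<union> Inr ` A"
        by (auto dest!: in_set_takeD in_set_dropD)
      then have "set ?J \<subseteq> Inl ` {..<d} \<union> Inr ` A"
        using r''_set(1) by (rule subset_trans[rotated])
      then have "(\<lambda>y\<in>tuples A d. g (subst_args y ?J)) \<in> N"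
        using r''_set(2) by (intro clone_fragment_subst[OF N d g]) auto
      also have "(\<lambda>y\<in>tuples A d. g (subst_args y ?J)) = (\<lambda>y\<in>tuples A d. g (r' (take i y @ \<beta> c # drop i y)))"
      proof (intro restrict_ext arg_cong[where f = g])
        fix y assume y: "y \<in> tuples A d"
        have "map (case_sum ((!) y) id) ?V = y"
          using map_nth[of y] tuples_length[OF y] by (simp add: comp_def)
        then show "subst_args y ?J = r' (take i y @ \<beta> c # drop i y)"
          unfolding subst_args_def r'' map_append list.map take_map[symmetric] drop_map[symmetric] by simp
      qed
      finally show "(\<lambda>y\<in>tuples A d. g (r' (take i y @ \<beta> c # drop i y))) \<in> N" .
      fix x assume x: "x \<in> tuples B d"
      show "?e (take i x @ c # drop i x)
          = (\<lambda>Y\<in>{[]}. g (r' (take i (map \<beta> x) @ \<beta> c # drop i (map \<beta> x))))"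
        using tuples_insert[OF x c, of i] r by (simp add: r' take_map drop_map)
    qed
    ultimately show ?thesis unfolding circledast_def ebtrl_def by auto
  qed
  note * = this
  have "e \<in> circledast ({[]} \<rightarrow>\<^sub>E A) B d curried" if \<gamma>_in: "\<gamma> \<in> curried" and e: "e \<in> eftrl B d \<gamma>" for \<gamma> e
  proof -
    obtain g where g: "g \<in> N" and \<gamma>: "\<gamma> = (\<lambda>x\<in>tuples B d. \<lambda>Y\<in>{[]}. g (map \<beta> x))"
      using \<gamma>_in by (auto simp: curried_def)
    have sub: "set (tl J) \<subseteq> set J" "set (butlast J) \<subseteq> set J" for J :: "'c list"
      by (cases J; auto dest: in_set_butlastD)+
    have "(\<lambda>x\<in>tuples B (Suc d). \<gamma> (tl x)) \<in> circledast ({[]} \<rightarrow>\<^sub>E A) B d curried"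
      unfolding \<gamma>
    proof (rule *[OF g, of tl tl tl])
      show "tl x \<in> tuples B d" if "x \<in> tuples B (Suc d)" for x
        using that sub(1)[of x] by (auto simp: tuples_def)
    qed (simp_all add: map_tl sub)
    moreover have "(\<lambda>x\<in>tuples B (Suc d). \<gamma> (butlast x)) \<in> circledast ({[]} \<rightarrow>\<^sub>E A) B d curried"
      unfolding \<gamma>
    proof (rule *[OF g, of butlast butlast butlast])
      show "butlast x \<in> tuples B d" if "x \<in> tuples B (Suc d)" for x
        using that sub(2)[of x] by (auto simp: tuples_def)
    qed (simp_all add: map_butlast sub)
    ultimately show ?thesis using e by (auto simp: eftrl_def)
  qed
  then show ?thesis unfolding simple_int_reflexive_def by blast
qed

lemma curried_transitive: "simple_transitive ({[]} \<rightarrow>\<^sub>E A) B d curried"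
proof -
  have "(\<lambda>x\<in>tuples B d. h (take j x @ x ! i # drop j x)) \<in> curried"
    if h: "h \<in> circledast ({[]} \<rightarrow>\<^sub>E A) B d curried" and ij: "i < j" "j \<le> d" for h i j
  proof -
    \<comment> \<open>The function \<open>h\<close> is pulled back along the bijection to an
      operation on \<open>A\<close>, to which \<open>Delta_subset_fragment\<close> applies.\<close>
    define h' where "h' = (\<lambda>y\<in>tuples A (Suc d). h (map (inv_into B \<beta>) y) [])"
    have hE: "h z \<in> {[]} \<rightarrow>\<^sub>E A" if "z \<in> tuples B (Suc d)" for z
      using h that by (auto simp: circledast_def dest: PiE_mem)
    have h': "h' \<in> ops A (Suc d)"
      using hE map_inv_beta by (fastforce simp: h'_def ops_def)
    have h_eq: "h z = (\<lambda>Y\<in>{[]}. h' (map \<beta> z))" if z: "z \<in> tuples B (Suc d)" for z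
    proof -
      have "h z = (\<lambda>Y\<in>{[]}. h z [])"
        using PiE_arb[OF hE[OF z]] by (auto simp: fun_eq_iff restrict_def)
      moreover have "h' (map \<beta> z) = h z []"
        using map_beta[OF z] map_inv_beta_beta[OF z] by (simp add: h'_def del: map_map)
      ultimately show ?thesis by simp
    qed
    have "(\<lambda>y\<in>tuples A d. h' (take i y @ c # drop i y)) \<in> N" if i: "i \<le> d" and c: "c \<in> A" for i c
    proof -
      let ?c = "inv_into B \<beta> c"
      have c': "?c \<in> B" using c bij_betw_inv_into[OF \<beta>] by (auto simp: bij_betw_def)
      have "(\<lambda>x\<in>tuples B d. h (take i x @ ?c # drop i x)) \<in> ebtrl B d h"
        unfolding ebtrl_def using i c' by blast
      then have "(\<lambda>x\<in>tuples B d. h (take i x @ ?c # drop i x)) \<in> curried"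
        using h by (auto simp: circledast_def)
      then obtain g where g: "g \<in> N"
        and eq: "(\<lambda>x\<in>tuples B d. h (take i x @ ?c # drop i x)) = (\<lambda>x\<in>tuples B d. \<lambda>Y\<in>{[]}. g (map \<beta> x))"
        by (auto simp: curried_def)
      have "(\<lambda>y\<in>tuples A d. h' (take i y @ c # drop i y)) = restrict g (tuples A d)"
      proof (rule restrict_ext)
        fix y assume y: "y \<in> tuples A d"
        let ?x = "map (inv_into B \<beta>) y"
        have "h' (take i y @ c # drop i y) = h (take i ?x @ ?c # drop i ?x) []"
          using tuples_insert[OF y c, of i] by (simp add: h'_def take_map drop_map)
        also have "\<dots> = g (map \<beta> ?x)"
          using fun_cong[OF fun_cong[OF eq, of ?x], of "[]"] map_inv_beta[OF y] by simp
        finally show "h' (take i y @ c # drop i y) = g y"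
          using map_beta_inv[OF y] by simp
      qed
      also have "\<dots> = g" using g N_ops by (auto simp: ops_def PiE_restrict)
      finally show ?thesis using g by simp
    qed
    then have "(\<lambda>y\<in>tuples A d. h' (take j y @ y ! i # drop j y)) \<in> N"
      using ij by (intro Delta_subset_fragment[OF N clone A d h']) auto
    then show ?thesis
    proof (rule curriedI)
      fix x assume x: "x \<in> tuples B d"
      have "x ! i \<in> B" using x ij by (auto intro: tuples_nth)
      then show "h (take j x @ x ! i # drop j x)
          = (\<lambda>Y\<in>{[]}. h' (take j (map \<beta> x) @ map \<beta> x ! i # drop j (map \<beta> x)))"
        using h_eq[OF tuples_insert[OF x, of "x ! i" j]] ij tuples_length[OF x]
        by (simp add: take_map drop_map)
    qed
  qed
  then show ?thesis by (auto simp: simple_transitive_def Delta_def)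
qed

lemma gquord_transport: "generalized_quasiorder A [(B, d)] (transport ` N)"
  unfolding generalized_quasiorder_def
proof (intro conjI ballI)
  have image: "curry_at [(B, d)] 0 ` transport ` N = curried"
    by (simp add: curried_def image_image curry_transport)
  show "transport ` N \<subseteq> arity_dom [(B, d)] \<rightarrow>\<^sub>E A"
    using N_ops map_beta by (fastforce simp: transport_def arity_dom_singleton ops_def)
  show "int_reflexive A [(B, d)] (transport ` N)"
    using curried_reflexive by (simp add: int_reflexive_def image curry_base_transport)
  show "transitive A [(B, d)] (transport ` N)"
    using curried_transitive by (simp add: transitive_def image curry_base_transport)
  fix c assume "c \<in> A"
  then have "(\<lambda>y\<in>tuples A d. c) \<in> N" using N(2) by (auto simp: const_ops_def)
  moreover have "transport (\<lambda>y\<in>tuples A d. c) = (\<lambda>X\<in>arity_dom [(B, d)]. c)"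
    unfolding transport_def using map_beta by (intro restrict_ext) (auto simp: arity_dom_singleton)
  ultimately show "(\<lambda>X\<in>arity_dom [(B, d)]. c) \<in> transport ` N" by (metis imageI)
qed

lemma transport_comp:
  "(\<lambda>X\<in>arity_dom [(B, d)]. f (map (\<lambda>g. g X) (map transport gs))) = transport (compose_op A d f gs)"
  unfolding transport_def compose_op_def using map_beta
  by (intro restrict_ext) (auto simp: arity_dom_singleton comp_def)

lemma transport_inject:
  assumes "transport g = transport g'" "g \<in> ops A d" "g' \<in> ops A d"
  shows "g = g'"
proof (rule PiE_ext)
  fix y assume y: "y \<in> tuples A d"
  then show "g y = g' y"
    using fun_cong[OF assms(1), of "[map (inv_into B \<beta>) y]"] map_inv_beta[OF y] map_beta_inv[OF y]
    by (simp add: transport_def arity_dom_singleton image_iff)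
qed (use assms(2,3) in \<open>auto simp: ops_def\<close>)

lemma preserves_transport_iff:
  assumes f: "f \<in> ops A d"
  shows "preserves d f [(B, d)] (transport ` N) \<longleftrightarrow> f \<in> N"
proof
  assume "f \<in> N"
  show "preserves d f [(B, d)] (transport ` N)"
    unfolding preserves_def
  proof
    fix gs assume gs: "gs \<in> tuples (transport ` N) d"
    define gs' where "gs' = map (inv_into N transport) gs"
    have "set gs' \<subseteq> N" "gs = map transport gs'"
      using gs by (auto simp: gs'_def tuples_def inv_into_into f_inv_into_f intro!: map_idI[symmetric])
    moreover have "compose_op A d f gs' \<in> N"
      using calculation gs by (intro clone_fragment_compose_op[OF N(1) d \<open>f \<in> N\<close>]) (auto simp: tuples_def)
    ultimately show "(\<lambda>X\<in>arity_dom [(B, d)]. f (map (\<lambda>g. g X) gs)) \<in> transport ` N"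
      by (simp only: transport_comp imageI)
  qed
next
  let ?ps = "map (projection A d) [0..<d]"
  assume "preserves d f [(B, d)] (transport ` N)"
  moreover have "map transport ?ps \<in> tuples (transport ` N) d"
    using clone_fragment_projection[OF N(1)] by (auto simp: tuples_def)
  ultimately have "transport (compose_op A d f ?ps) \<in> transport ` N"
    unfolding preserves_def transport_comp[symmetric] by blast
  moreover have "compose_op A d f ?ps = f"
  proof -
    have "compose_op A d f ?ps = restrict f (tuples A d)"
      unfolding compose_op_def
    proof (intro restrict_ext arg_cong[where f = f])
      fix x assume x: "x \<in> tuples A d"
      then show "map (\<lambda>g. g x) ?ps = x"
        using map_nth[of x] tuples_length[OF x] by (simp add: comp_def projection_def)
    qed
    then show ?thesis using f by (simp add: ops_def PiE_restrict)
  qed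
  ultimately obtain g where "g \<in> N" "transport f = transport g" by auto
  then show "f \<in> N" using transport_inject f N_ops by blast
qed

end

section \<open>The two inclusions\<close>

theorem theorem7p3:
  fixes A :: "'a set" and M :: "('a list \<Rightarrow> 'a) set" and d :: nat
  assumes "finite A" and "A \<noteq> {}"
    and "1 \<le> d"
    and "M \<subseteq> ops A d"
  shows "d_closure A d M = Pol d A (GQuord_inv d A M)"
proof
  let ?T = "GQuord_inv d A M"
  have T: "canonical_arity \<alpha>" "dimension \<alpha> = d" "generalized_quasiorder A \<alpha> \<rho>"
    if "(\<alpha>, \<rho>) \<in> ?T" for \<alpha> \<rho>
    using that by (auto simp: GQuord_inv_def GQuord_def)
  have clone: "is_clone A (Pol_ops A ?T)"
    by (rule is_clone_Pol_ops) (auto dest!: T(3) generalized_quasiorderD(1))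
  have level: "level (Pol_ops A ?T) d = Pol d A ?T"
    using assms(3) by (rule level_Pol_ops)
  have M: "M \<subseteq> Pol d A ?T"
    using assms(4) by (auto simp: Pol_def GQuord_inv_def)
  have const: "const_ops A d \<subseteq> Pol d A ?T"
  proof
    fix f assume "f \<in> const_ops A d"
    then obtain c where c: "c \<in> A" and f: "f = (\<lambda>x\<in>tuples A d. c)" by (auto simp: const_ops_def)
    have "preserves d f \<alpha> \<rho>" if "(\<alpha>, \<rho>) \<in> ?T" for \<alpha> \<rho>
      unfolding preserves_def
    proof
      fix gs assume gs: "gs \<in> tuples \<rho> d"
      have "(\<lambda>X\<in>arity_dom \<alpha>. f (map (\<lambda>g. g X) gs)) = (\<lambda>X\<in>arity_dom \<alpha>. c)"
        using gs generalized_quasiorderD(1)[OF T(3)[OF that]]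
        by (intro restrict_ext) (auto simp: f tuples_def dest: subsetD PiE_mem)
      then show "(\<lambda>X\<in>arity_dom \<alpha>. f (map (\<lambda>g. g X) gs)) \<in> \<rho>"
        using generalized_quasiorderD(4)[OF T(3)[OF that] c] by simp
    qed
    then show "f \<in> Pol d A ?T" using c by (auto simp: Pol_def f ops_def)
  qed
  \<comment> \<open>With this the star is a clone, so \<open>Pol d A ?T\<close> is itself one of the
    sets \<open>N\<close> that are intersected.\<close>
  have "star A d (Pol d A ?T) = Pol_ops A ?T"
  proof
    show "Pol_ops A ?T \<subseteq> star A d (Pol d A ?T)"
    proof
      fix F assume F: "F \<in> Pol_ops A ?T"
      then have "trl A d F \<subseteq> Pol d A ?T"
        using trl_subset_level[OF clone _ assms(3), of "fst F" "snd F"] const unfolding level by simp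
      then show "F \<in> star A d (Pol d A ?T)"
        using F by (auto simp: star_def Pol_ops_def)
    qed
    show "star A d (Pol d A ?T) \<subseteq> Pol_ops A ?T"
    proof clarify
      fix n f assume F: "(n, f) \<in> star A d (Pol d A ?T)"
      have "preserves n f \<alpha> \<rho>" if "(\<alpha>, \<rho>) \<in> ?T" for \<alpha> \<rho>
      proof (rule preserves_of_trl[OF T(3,2)[OF that]])
        show "f \<in> ops A n" "1 \<le> n" using F by (auto simp: star_def Op_def)
        \<comment> \<open>Every canonical factor \<open>{..<m}\<close> contains \<open>0\<close>,
          because \<open>1 \<le> m\<close>.\<close>
        have "map (\<lambda>(B, k). replicate k 0) \<alpha> \<in> arity_dom \<alpha>"
          using T(1)[OF that] unfolding canonical_arity_def arity_dom_iff
          by (fastforce simp: tuples_def case_prod_unfold dest: nth_mem)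
        then show "map (\<lambda>(B, k). replicate k 0) \<alpha> \<in> arity_dom \<alpha>" .
        show "preserves d f' \<alpha> \<rho>" if "f' \<in> trl A d (n, f)" for f'
          using F that \<open>(\<alpha>, \<rho>) \<in> ?T\<close> by (auto simp: star_def Pol_def)
      qed
      then show "(n, f) \<in> Pol_ops A ?T"
        using F by (auto simp: star_def Pol_ops_def)
    qed
  qed
  then show "d_closure A d M \<subseteq> Pol d A ?T"
    unfolding d_closure_def
    using M const clone clone_fragment_level[OF clone, of d] level by (intro Inter_lower) auto
next
  \<comment> \<open>Finiteness of \<open>A\<close> provides the ordinal with which \<open>A\<close>
    is identified, so that the relation formed by \<open>N\<close> acquires a canonical
    arity.\<close>
  obtain \<beta> where \<beta>: "bij_betw \<beta> {..<card A} A"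
    using ex_bij_betw_nat_finite[OF assms(1)] by (auto simp: atLeast0LessThan)
  have card: "1 \<le> card A" using assms(1,2) by (simp add: Suc_leI card_gt_0_iff)
  show "Pol d A (GQuord_inv d A M) \<subseteq> d_closure A d M"
    unfolding d_closure_def
  proof (intro Inter_greatest, clarify)
    fix N f assume MN: "M \<union> const_ops A d \<subseteq> N" and N: "clone_fragment A d N" "is_clone A (star A d N)"
      and f: "f \<in> Pol d A (GQuord_inv d A M)"
    note ctx = \<beta> assms(2,3) N(1) _ N(2)
    let ?\<rho> = "transport {..<card A} \<beta> d ` N"
    have "([({..<card A}, d)], ?\<rho>) \<in> GQuord_inv d A M"
      using gquord_transport[OF ctx] preserves_transport_iff[OF ctx] MN assms(3,4) card
      by (auto simp: GQuord_inv_def GQuord_def canonical_arity_def dimension_def)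
    then have "preserves d f [({..<card A}, d)] ?\<rho>" "f \<in> ops A d"
      using f by (auto simp: Pol_def)
    then show "f \<in> N"
      using preserves_transport_iff[OF ctx] MN by blast
  qed
qed

end
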